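(* Let $K$ be an algebraically closed field of characteristic $p=2$, let $k\ge3$ be odd and $n\ge2$, let $\lambda_1,\ldots,\lambda_{n-2}\in K\setminus\{0,1\}$ be pairwise different, and let $F_{k,n}=C^k_{\lambda_1,\ldots,\lambda_{n-2}}$ with Cartier operator $\mathscr{C}_{k,n}$ on $H^{1,0}(F_{k,n})$. Set $\delta_3=1$ and $\delta_{3+j}=\lambda_j$ for $j=1,\ldots,n-2$. For $(r;\alpha_3,\ldots,\alpha_{n+1})\in I_{k,n}$ let $$A=\{j\in\{3,\ldots,n+1\}:\alpha_j\text{ is odd}\},\qquad \widehat{\alpha}_j=\begin{cases}\alpha_j,& j\notin A,\\ k+\alpha_j,& j\in A.\end{cases}$$ Then $\mathscr{C}_{k,n}(\theta_{r;\alpha_3,\ldots,\alpha_{n+1}})$ equals: 1. $0$, if $r$ is even and $A=\emptyset$; 2. $\theta_{\frac{r+k-1}{2};\frac{\widehat{\alpha}_3}{2},\ldots,\frac{\widehat{\alpha}_{n+1}}{2}}$, if $r$ is even and $\#A=1$; 3. $\displaystyle\sum_{s=0}^{\frac{\#A-2}{2}}q_s^{1/2}\,\theta_{sk+\frac{r-1+k}{2};\frac{\widehat{\alpha}_3}{2},\ldots,\frac{\widehat{\alpha}_{n+1}}{2}}$, if $r$ is even and $\#A\ge2$ is even; 4. $\displaystyle\sum_{s=0}^{\frac{\#A-1}{2}}q_s^{1/2}\,\theta_{sk+\frac{r-1+k}{2};\frac{\widehat{\alpha}_3}{2},\ldots,\frac{\widehat{\alpha}_{n+1}}{2}}$, if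 $r$ is even and $\#A\ge3$ is odd; 5. $\theta_{\frac{r-1}{2};\frac{\alpha_3}{2},\ldots,\frac{\alpha_{n+1}}{2}}$, if $r$ is odd and $A=\emptyset$; 6. $\delta_{j_0}^{1/2}\,\theta_{\frac{r-1}{2};\frac{\alpha_3}{2},\ldots,\frac{\alpha_{j_0-1}}{2},\frac{\alpha_{j_0}+k}{2},\frac{\alpha_{j_0+1}}{2},\ldots,\frac{\alpha_{n+1}}{2}}$, if $r$ is odd and $A=\{j_0\}$; 7. $\displaystyle\sum_{s=0}^{\frac{\#A}{2}}d_s^{1/2}\,\theta_{sk+\frac{r-1}{2};\frac{\widehat{\alpha}_3}{2},\ldots,\frac{\widehat{\alpha}_{n+1}}{2}}$, if $r$ is odd and $\#A\ge2$ is even; 8. $\displaystyle\sum_{s=0}^{\frac{\#A-1}{2}}d_s^{1/2}\,\theta_{sk+\frac{r-1}{2};\frac{\widehat{\alpha}_3}{2},\ldots,\frac{\widehat{\alpha}_{n+1}}{2}}$, if $r$ is odd and $\#A\ge3$ is odd. Here $q_s$ is the sum of all products of $\#A-2s-1$ of the elements $\delta_j$, $j\in A$, with distinct indices (the elementary symmetric polynomial of degree $\#A-2s-1$), with $q_{(\#A-1)/2}=1$ when $\#A$ is odd; and $d_s$ is the sum of all products of $\#A-2s$ of the elements $\delta_j$, $j\in A$, with distinct indices, with $d_{\#A/2}=1$ when $\#A$ is even.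
   Context: $C^k_{\lambda_1,\ldots,\lambda_{n-2}}\subset\mathbb{P}^n_K$ is the non-singular irreducible projective curve with equations $$x_1^k+x_2^k+x_3^k=0,\quad \lambda_1x_1^k+x_2^k+x_4^k=0,\ \ldots,\ \lambda_{n-2}x_1^k+x_2^k+x_{n+1}^k=0$$ (for $n=2$ it is the Fermat curve $x_1^k+x_2^k+x_3^k=0$). On it set $y_j=x_j/x_1$ for $j=2,\ldots,n+1$ and $z=y_2$. For $r\in\mathbb{Z}$ and $\alpha_3,\ldots,\alpha_{n+1}\in\{0,1,\ldots,k-1\}$ put $$\theta_{r;\alpha_3,\ldots,\alpha_{n+1}}=\frac{z^r\,dz}{y_3^{\alpha_3}\cdots y_{n+1}^{\alpha_{n+1}}},\qquad I_{k,n}=\{(r;\alpha_3,\ldots,\alpha_{n+1}):\alpha_j\in\{0,\ldots,k-1\},\ 0\le r\le\alpha_3+\cdots+\alpha_{n+1}-2\}.$$ $H^{1,0}(X)$ denotes the space of holomorphic (everywhere regular) one-forms on $X$; the forms $\theta_{r;\alpha_3,\ldots,\alpha_{n+1}}$ with index in $I_{k,n}$ belong to $H^{1,0}(F_{k,n})$. Cartier operator in characteristic $p>0$: fix $z\in K(X)\setminus K(X)^p$. A holomorphic form can be written $w\,dz$ with $w=u_0^p+u_1^pz+\cdots+u_{p-1}^pz^{p-1}$, $u_i\in K(X)$; then $\mathscr{C}(w\,dz)=u_{p-1}\,dz$. It is a $1/p$-linear operator $H^{1,0}(X)\to H^{1,0}(X)$ independent of the choice of $z$. Here $p=2$, $X=F_{k,n}$,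 and $\mathscr{C}=\mathscr{C}_{k,n}$. *)

theory Defs
  imports
    "HOL-Library.Poly_Mapping"
    "HOL-Library.Function_Algebras"
    "HOL-Library.FuncSet"
    "HOL-Computational_Algebra.Computational_Algebra"
begin

section \<open>Homogeneous polynomials and projective space\<close>

text \<open>A monomial assigns an exponent to each variable; multiplication of \<open>'a mpol\<close> is the
  convolution product of Poly\_Mapping, that is, the product of polynomials. The homogeneous
  coordinates of \<open>P^n\<close> are \<open>x_1, \<dots>, x_(n+1)\<close>.\<close>

type_synonym 'a mpol = "(nat \<Rightarrow>\<^sub>0 nat) \<Rightarrow>\<^sub>0 'a"

definition Var :: "nat \<Rightarrow> 'a::comm_ring_1 mpol" where
  "Var i = Poly_Mapping.single (Poly_Mapping.single i 1) 1"

definition Const :: "'a::comm_ring_1 \<Rightarrow> 'a mpol" where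
  "Const c = Poly_Mapping.single 0 c"

definition mp_eval :: "(nat \<Rightarrow> 'a::comm_ring_1) \<Rightarrow> 'a mpol \<Rightarrow> 'a" where
  "mp_eval x P = (\<Sum>m\<in>Poly_Mapping.keys P.
     Poly_Mapping.lookup P m * (\<Prod>i\<in>Poly_Mapping.keys m. x i ^ Poly_Mapping.lookup m i))"

definition homogeneous :: "nat \<Rightarrow> nat \<Rightarrow> 'a::comm_ring_1 mpol \<Rightarrow> bool" where
  "homogeneous n d P \<longleftrightarrow> (\<forall>m\<in>Poly_Mapping.keys P.
     Poly_Mapping.keys m \<subseteq> {1..n+1} \<and>
     (\<Sum>i\<in>Poly_Mapping.keys m. Poly_Mapping.lookup m i) = d)"

text \<open>A subset of \<open>P^n\<close> is given by the set of all homogeneous coordinate vectors of its points.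
  Everything below that depends on such a vector is invariant under scaling and ignores the
  entries with index outside \<open>{1..n+1}\<close>.\<close>

definition vanishes_on :: "(nat \<Rightarrow> 'a::comm_ring_1) set \<Rightarrow> 'a mpol \<Rightarrow> bool" where
  "vanishes_on X P \<longleftrightarrow> (\<forall>x\<in>X. mp_eval x P = 0)"


section \<open>The curve\<close>

definition delta :: "(nat \<Rightarrow> 'a::comm_ring_1) \<Rightarrow> nat \<Rightarrow> 'a" where
  "delta lam j = (if j = 3 then 1 else lam (j - 3))"

definition curve :: "nat \<Rightarrow> nat \<Rightarrow> (nat \<Rightarrow> 'a::comm_ring_1) \<Rightarrow> (nat \<Rightarrow> 'a) set" where
  "curve k n lam = {x. (\<exists>i\<in>{1..n+1}. x i \<noteq> 0) \<and>
     x 1 ^ k + x 2 ^ k + x 3 ^ k = 0 \<and>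
     (\<forall>j\<in>{1..n-2}. lam j * x 1 ^ k + x 2 ^ k + x (j + 3) ^ k = 0)}"


section \<open>The function field\<close>

text \<open>For an irreducible projective set \<open>X\<close>, the field \<open>K(X)\<close> consists of the fractions \<open>P/Q\<close> of
  homogeneous polynomials of the same degree with \<open>Q\<close> not in the ideal of \<open>X\<close>, modulo
  \<open>P/Q = P'/Q'\<close> iff \<open>P Q' - P' Q\<close> is in the ideal of \<open>X\<close>. As \<open>X\<close> depends on term parameters, \<open>K(X)\<close>
  is not definable as a type. Instead, \<open>is_function_field n X fr\<close> says that \<open>(P, Q) \<mapsto> fr P Q\<close>
  induces an isomorphism from the field just described onto the whole type \<open>'f\<close>.\<close>

definition is_fraction ::
  "nat \<Rightarrow> (nat \<Rightarrow> 'a::comm_ring_1) set \<Rightarrow> 'a mpol \<Rightarrow> 'a mpol \<Rightarrow> bool" where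
  "is_fraction n X P Q \<longleftrightarrow>
     (\<exists>d. homogeneous n d P \<and> homogeneous n d Q) \<and> \<not> vanishes_on X Q"

definition is_function_field ::
  "nat \<Rightarrow> (nat \<Rightarrow> 'a::field) set \<Rightarrow> ('a mpol \<Rightarrow> 'a mpol \<Rightarrow> 'f::field) \<Rightarrow> bool" where
  "is_function_field n X fr \<longleftrightarrow>
     (\<forall>P Q P' Q'. is_fraction n X P Q \<longrightarrow> is_fraction n X P' Q' \<longrightarrow>
        (fr P Q = fr P' Q' \<longleftrightarrow> vanishes_on X (P * Q' - P' * Q)) \<and>
        fr P Q + fr P' Q' = fr (P * Q' + P' * Q) (Q * Q') \<and>
        fr P Q * fr P' Q' = fr (P * P') (Q * Q')) \<and>
     (\<forall>f. \<exists>P Q. is_fraction n X P Q \<and> f = fr P Q)"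

definition const_fun :: "('a::field mpol \<Rightarrow> 'a mpol \<Rightarrow> 'f::field) \<Rightarrow> 'a \<Rightarrow> 'f" where
  "const_fun fr c = fr (Const c) 1"

definition regular_at ::
  "nat \<Rightarrow> (nat \<Rightarrow> 'a::field) set \<Rightarrow> ('a mpol \<Rightarrow> 'a mpol \<Rightarrow> 'f::field) \<Rightarrow> (nat \<Rightarrow> 'a) \<Rightarrow> 'f \<Rightarrow> bool"
  where
  "regular_at n X fr x f \<longleftrightarrow>
     (\<exists>P Q. is_fraction n X P Q \<and> mp_eval x Q \<noteq> 0 \<and> f = fr P Q)"


section \<open>Differential forms\<close>

text \<open>Differential forms are elements of the dual of the \<open>K(X)\<close>-space of \<open>K\<close>-derivations of \<open>K(X)\<close>,
  with \<open>(f dg)(D) = f * D g\<close>; for a function field over a perfect field this dual is the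
  module of Kaehler differentials. A form is set to \<open>0\<close> on arguments that are not derivations, so
  that equality of forms is equality of HOL functions.\<close>

type_synonym 'f form = "('f \<Rightarrow> 'f) \<Rightarrow> 'f"

definition is_derivation ::
  "('a::field mpol \<Rightarrow> 'a mpol \<Rightarrow> 'f::field) \<Rightarrow> ('f \<Rightarrow> 'f) \<Rightarrow> bool" where
  "is_derivation fr D \<longleftrightarrow>
     (\<forall>f g. D (f + g) = D f + D g) \<and>
     (\<forall>f g. D (f * g) = f * D g + g * D f) \<and>
     (\<forall>c. D (const_fun fr c) = 0)"

definition diff :: "('a::field mpol \<Rightarrow> 'a mpol \<Rightarrow> 'f::field) \<Rightarrow> 'f \<Rightarrow> 'f form" where
  "diff fr g = (\<lambda>D. if is_derivation fr D then D g else 0)"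

definition scale :: "'f::field \<Rightarrow> 'f form \<Rightarrow> 'f form" (infixr "\<cdot>\<^sub>\<Omega>" 70) where
  "f \<cdot>\<^sub>\<Omega> \<omega> = (\<lambda>D. f * \<omega> D)"

text \<open>A form is regular at \<open>x\<close> if it lies in the \<open>O_x\<close>-module generated by the \<open>dg\<close> with \<open>g \<in> O_x\<close>,
  where \<open>O_x\<close> is the local ring of \<open>X\<close> at \<open>x\<close>.\<close>

definition form_regular_at ::
  "nat \<Rightarrow> (nat \<Rightarrow> 'a::field) set \<Rightarrow> ('a mpol \<Rightarrow> 'a mpol \<Rightarrow> 'f::field) \<Rightarrow> (nat \<Rightarrow> 'a) \<Rightarrow> 'f form \<Rightarrow> bool"
  where
  "form_regular_at n X fr x \<omega> \<longleftrightarrow>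
     (\<exists>(m::nat) f g. (\<forall>i<m. regular_at n X fr x (f i) \<and> regular_at n X fr x (g i)) \<and>
        \<omega> = (\<Sum>i<m. f i \<cdot>\<^sub>\<Omega> diff fr (g i)))"

definition H10 ::
  "nat \<Rightarrow> (nat \<Rightarrow> 'a::field) set \<Rightarrow> ('a mpol \<Rightarrow> 'a mpol \<Rightarrow> 'f::field) \<Rightarrow> 'f form set" where
  "H10 n X fr = {\<omega>. \<forall>x\<in>X. form_regular_at n X fr x \<omega>}"

text \<open>The Cartier operator computed with respect to \<open>t\<close>, which has to lie outside \<open>K(X)^p\<close>
  (then the result does not depend on \<open>t\<close>).\<close>

definition cartier ::
  "nat \<Rightarrow> (nat \<Rightarrow> 'a::field) set \<Rightarrow> ('a mpol \<Rightarrow> 'a mpol \<Rightarrow> 'f::field) \<Rightarrow> 'f \<Rightarrow> 'f form \<Rightarrow> 'f form"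
  where
  "cartier n X fr t = restrict
     (\<lambda>\<omega>. THE \<eta>. \<exists>u. \<omega> = (\<Sum>i<CHAR('a). u i ^ CHAR('a) * t ^ i) \<cdot>\<^sub>\<Omega> diff fr t \<and>
                      \<eta> = u (CHAR('a) - 1) \<cdot>\<^sub>\<Omega> diff fr t)
     (H10 n X fr)"


section \<open>The forms \<open>\<theta>\<close> and the coefficients\<close>

definition coord :: "('a::field mpol \<Rightarrow> 'a mpol \<Rightarrow> 'f::field) \<Rightarrow> nat \<Rightarrow> 'f" where
  "coord fr j = fr (Var j) (Var 1)"

definition theta ::
  "nat \<Rightarrow> ('a::field mpol \<Rightarrow> 'a mpol \<Rightarrow> 'f::field) \<Rightarrow> int \<Rightarrow> (nat \<Rightarrow> nat) \<Rightarrow> 'f form" where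
  "theta n fr r \<alpha> =
     (coord fr 2 powi r / (\<Prod>j\<in>{3..n+1}. coord fr j ^ \<alpha> j)) \<cdot>\<^sub>\<Omega> diff fr (coord fr 2)"

definition I_set :: "nat \<Rightarrow> nat \<Rightarrow> (int \<times> (nat \<Rightarrow> nat)) set" where
  "I_set k n = {(r, \<alpha>). (\<forall>j\<in>{3..n+1}. \<alpha> j \<le> k - 1) \<and>
     0 \<le> r \<and> r \<le> (\<Sum>j\<in>{3..n+1}. int (\<alpha> j)) - 2}"

definition odd_indices :: "nat \<Rightarrow> (nat \<Rightarrow> nat) \<Rightarrow> nat set" where
  "odd_indices n \<alpha> = {j\<in>{3..n+1}. odd (\<alpha> j)}"

definition alpha_hat :: "nat \<Rightarrow> nat \<Rightarrow> (nat \<Rightarrow> nat) \<Rightarrow> nat \<Rightarrow> nat" where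
  "alpha_hat k n \<alpha> j = (if j \<in> odd_indices n \<alpha> then k + \<alpha> j else \<alpha> j)"

definition esym :: "nat set \<Rightarrow> (nat \<Rightarrow> 'a::comm_ring_1) \<Rightarrow> nat \<Rightarrow> 'a" where
  "esym A \<delta> m = (\<Sum>T | T \<subseteq> A \<and> card T = m. \<Prod>j\<in>T. \<delta> j)"

definition q_coeff :: "(nat \<Rightarrow> 'a::comm_ring_1) \<Rightarrow> nat set \<Rightarrow> nat \<Rightarrow> 'a" where
  "q_coeff lam A s = esym A (delta lam) (card A - 2 * s - 1)"

definition d_coeff :: "(nat \<Rightarrow> 'a::comm_ring_1) \<Rightarrow> nat set \<Rightarrow> nat \<Rightarrow> 'a" where
  "d_coeff lam A s = esym A (delta lam) (card A - 2 * s)"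

text \<open>The unique square root in an algebraically closed field of characteristic 2.\<close>

definition sqrt_char2 :: "'a::field \<Rightarrow> 'a" where
  "sqrt_char2 c = (THE b. b ^ 2 = c)"

end

theory Submission
  imports Defs
begin

text \<open>
  Write \<open>z = y\<^sub>2\<close>, \<open>L = K(X)\<close>, and \<open>\<theta> = w dz\<close>. The proof computes in the coordinates given by the
  decomposition \<open>L = L\<^sup>2 + L\<^sup>2 z\<close>, where the Cartier operator is \<open>(a\<^sup>2 + b\<^sup>2 z) dz \<mapsto> b dz\<close>.

  The affine equations of the curve are \<open>y\<^sub>j\<^sup>k = z\<^sup>k + \<delta>\<^sub>j\<close>. As \<open>k\<close> is odd, multiplying numerator and
  denominator of \<open>w = z\<^sup>r / \<Prod>\<^sub>j y\<^sub>j\<^bsup>\<alpha>\<^sub>j\<^esup>\<close> by \<open>y\<^sub>j\<^sup>k\<close> for every \<open>j\<close> in the set \<open>A\<close> of indices with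
  \<open>\<alpha>\<^sub>j\<close> odd turns the denominator into a square \<open>Y\<^sup>2\<close>
  (\<open>denominator_square\<close>) and the numerator into \<open>z\<^sup>r \<Prod>\<^sub>j (z\<^sup>k + \<delta>\<^sub>j)\<close>, \<open>j \<in> A\<close>. Expanded by
  elementary symmetric polynomials, this is a combination of the powers \<open>z\<^bsup>k m + r\<^esup>\<close> with
  constant coefficients, which are squares because \<open>K\<close> is perfect. Even powers of \<open>z\<close> contribute
  to \<open>a\<^sup>2\<close> and odd powers to \<open>b\<^sup>2 z\<close>, so that the image is the sum over the \<open>m\<close> with \<open>k m + r\<close>
  odd (\<open>cartier_theta\<close>). Even \<open>r\<close> selects \<open>m = 2 s + 1\<close>, odd \<open>r\<close> selects \<open>m = 2 s\<close>; the
  eight cases only differ in where the sum ends, down to a single term or none.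

  Three facts justify this computation.
  \<^item> \<open>L = L\<^sup>2 + L\<^sup>2 z\<close> (\<open>square_plane_UNIV\<close>). The right-hand side is a field, and it contains the
    generators: \<open>y\<^sub>j\<close> is the square \<open>y\<^sub>j\<^bsup>k+1\<^esup>\<close> divided by \<open>z\<^sup>k + \<delta>\<^sub>j\<close>.
  \<^item> The operator computed with \<open>t\<close> agrees with the recipe for \<open>z\<close> (\<open>cartier_eq\<close>): write
    \<open>t\<close> as \<open>c\<^sup>2 + d\<^sup>2 z\<close> and substitute.
  \<^item> \<open>\<theta>\<close> is holomorphic (\<open>theta_holomorphic\<close>), as the operator is only defined on holomorphic
    forms. This is a local computation with one of the parameters \<open>z\<close>, \<open>y\<^sub>j\<close> (where \<open>y\<^sub>j\<close>
    vanishes) and \<open>1/z\<close> (where \<open>x\<^sub>1 = 0\<close>).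

  Behind all of them is the irreducibility of the curve. It is not proved from the equations: it
  holds because a field \<open>L\<close> of fractions is assumed to exist (\<open>nonvanishing_mult\<close>).
\<close>

section \<open>Evaluation and homogeneity of polynomials\<close>

definition monomial_value :: "(nat \<Rightarrow> 'a::comm_ring_1) \<Rightarrow> (nat \<Rightarrow>\<^sub>0 nat) \<Rightarrow> 'a" where
  "monomial_value x m = (\<Prod>i\<in>Poly_Mapping.keys m. x i ^ Poly_Mapping.lookup m i)"

definition monomial_degree :: "(nat \<Rightarrow>\<^sub>0 nat) \<Rightarrow> nat" where
  "monomial_degree m = (\<Sum>i\<in>Poly_Mapping.keys m. Poly_Mapping.lookup m i)"

lemma monomial_value_add:
  "monomial_value x (m + m') = monomial_value x m * monomial_value x m'"
proof -
  let ?S = "Poly_Mapping.keys m \<union> Poly_Mapping.keys m'"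
  have ext: "monomial_value x l = (\<Prod>i\<in>?S. x i ^ Poly_Mapping.lookup l i)"
    if "Poly_Mapping.keys l \<subseteq> ?S" for l
    unfolding monomial_value_def using that
    by (intro prod.mono_neutral_left) (auto simp: not_in_keys_iff_lookup_eq_zero)
  have "Poly_Mapping.keys (m + m') \<subseteq> ?S"
    by (rule keys_add)
  then show ?thesis
    by (simp add: ext lookup_add power_add prod.distrib)
qed

lemma monomial_degree_add:
  "monomial_degree (m + m') = monomial_degree m + monomial_degree m'"
  unfolding monomial_degree_def by (rule setsum_keys_plus_distrib) auto

lemma mp_eval_altdef:
  "mp_eval x P = (\<Sum>m\<in>Poly_Mapping.keys P. Poly_Mapping.lookup P m * monomial_value x m)"
  by (simp add: mp_eval_def monomial_value_def)

lemma mp_eval_add: "mp_eval x (P + Q) = mp_eval x P + mp_eval x Q"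
  unfolding mp_eval_altdef
  by (rule setsum_keys_plus_distrib) (auto simp: distrib_right)

lemma mp_eval_0 [simp]: "mp_eval x 0 = 0"
  by (simp add: mp_eval_def)

lemma mp_eval_uminus: "mp_eval x (- P) = - mp_eval x P"
  using mp_eval_add[of x P "- P"] by (simp add: eq_neg_iff_add_eq_0 add.commute)

lemma mp_eval_diff: "mp_eval x (P - Q) = mp_eval x P - mp_eval x Q"
  using mp_eval_add[of x P "- Q"] by (simp add: mp_eval_uminus)

lemma mp_eval_sum: "mp_eval x (sum f I) = (\<Sum>i\<in>I. mp_eval x (f i))"
  by (induction I rule: infinite_finite_induct) (auto simp: mp_eval_add)

lemma mp_eval_single: "mp_eval x (Poly_Mapping.single m c) = c * monomial_value x m"
  by (cases "c = 0") (auto simp: mp_eval_altdef)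

lemma mpol_sum_single:
  "P = (\<Sum>m\<in>Poly_Mapping.keys P. Poly_Mapping.single m (Poly_Mapping.lookup P m))"
  by (rule poly_mapping_eqI)
    (auto simp: lookup_sum lookup_single when_def not_in_keys_iff_lookup_eq_zero)

lemma mp_eval_mult: "mp_eval x (P * Q) = mp_eval x P * mp_eval x Q"
proof -
  have "P * Q = (\<Sum>m\<in>Poly_Mapping.keys P. \<Sum>m'\<in>Poly_Mapping.keys Q.
      Poly_Mapping.single (m + m') (Poly_Mapping.lookup P m * Poly_Mapping.lookup Q m'))"
    by (subst mpol_sum_single[of P], subst mpol_sum_single[of Q])
      (simp add: sum_product mult_single)
  then show ?thesis
    by (simp add: mp_eval_sum mp_eval_single monomial_value_add)
      (simp add: mp_eval_altdef sum_product mult_ac)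
qed

lemma mp_eval_Const [simp]: "mp_eval x (Const c) = c"
  by (simp add: Const_def mp_eval_single monomial_value_def)

lemma Const_1: "Const 1 = 1"
  by (simp add: Const_def)

lemma mp_eval_1 [simp]: "mp_eval x 1 = 1"
  by (simp flip: Const_1)

lemma mp_eval_Var [simp]: "mp_eval x (Var i) = x i"
  by (simp add: Var_def mp_eval_single monomial_value_def)

lemma mp_eval_power: "mp_eval x (P ^ d) = mp_eval x P ^ d"
  by (induction d) (auto simp: mp_eval_mult)

lemma homogeneous_altdef:
  "homogeneous n d P \<longleftrightarrow>
     (\<forall>m\<in>Poly_Mapping.keys P. Poly_Mapping.keys m \<subseteq> {1..n+1} \<and> monomial_degree m = d)"
  by (simp add: homogeneous_def monomial_degree_def)

lemma homogeneous_0 [simp]: "homogeneous n d 0"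
  by (simp add: homogeneous_altdef)

lemma homogeneous_add: "homogeneous n d P \<Longrightarrow> homogeneous n d Q \<Longrightarrow> homogeneous n d (P + Q)"
  using keys_add[of P Q] by (auto simp: homogeneous_altdef)

lemma homogeneous_mult:
  assumes "homogeneous n d P" "homogeneous n e Q"
  shows "homogeneous n (d + e) (P * Q)"
  unfolding homogeneous_altdef
proof
  fix m assume "m \<in> Poly_Mapping.keys (P * Q)"
  then obtain a b where m: "m = a + b" "a \<in> Poly_Mapping.keys P" "b \<in> Poly_Mapping.keys Q"
    using keys_mult[of P Q] by blast
  then show "Poly_Mapping.keys m \<subseteq> {1..n+1} \<and> monomial_degree m = d + e"
    using assms keys_add[of a b] by (fastforce simp: homogeneous_altdef monomial_degree_add)
qed

lemma homogeneous_Const [simp]: "homogeneous n 0 (Const c)"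
  by (cases "c = 0") (auto simp: homogeneous_altdef Const_def monomial_degree_def)

lemma homogeneous_1 [simp]: "homogeneous n 0 1"
  by (simp flip: Const_1)

lemma homogeneous_Var: "i \<in> {1..n+1} \<Longrightarrow> homogeneous n 1 (Var i :: 'a::comm_ring_1 mpol)"
  by (auto simp: homogeneous_altdef Var_def monomial_degree_def)

lemma homogeneous_power: "homogeneous n d P \<Longrightarrow> homogeneous n (e * d) (P ^ e)"
  by (induction e) (auto dest: homogeneous_mult)

lemma homogeneous_Var_power:
  "i \<in> {1..n+1} \<Longrightarrow> homogeneous n d (Var i ^ d :: 'a::comm_ring_1 mpol)"
  using homogeneous_power[OF homogeneous_Var, of i n d] by simp

section \<open>Fractions and the function field\<close>

lemma is_fractionI:
  "homogeneous n d P \<Longrightarrow> homogeneous n d Q \<Longrightarrow> \<not> vanishes_on X Q \<Longrightarrow> is_fraction n X P Q"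
  by (auto simp: is_fraction_def)

locale function_field =
  fixes n :: nat and X :: "(nat \<Rightarrow> 'a::field) set"
    and fr :: "'a mpol \<Rightarrow> 'a mpol \<Rightarrow> 'f::field"
  assumes is_function_field: "is_function_field n X fr"
begin

lemma fr_eq_iff:
  "is_fraction n X P Q \<Longrightarrow> is_fraction n X P' Q' \<Longrightarrow>
    fr P Q = fr P' Q' \<longleftrightarrow> (\<forall>x\<in>X. mp_eval x P * mp_eval x Q' = mp_eval x P' * mp_eval x Q)"
  using is_function_field
  by (auto simp: is_function_field_def vanishes_on_def mp_eval_diff mp_eval_mult)

lemma fr_add:
  "is_fraction n X P Q \<Longrightarrow> is_fraction n X P' Q' \<Longrightarrow>
    fr P Q + fr P' Q' = fr (P * Q' + P' * Q) (Q * Q')"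
  using is_function_field by (auto simp: is_function_field_def)

lemma fr_mult:
  "is_fraction n X P Q \<Longrightarrow> is_fraction n X P' Q' \<Longrightarrow> fr P Q * fr P' Q' = fr (P * P') (Q * Q')"
  using is_function_field by (auto simp: is_function_field_def)

lemma fr_surj: obtains P Q where "is_fraction n X P Q" "f = fr P Q"
  using is_function_field unfolding is_function_field_def by metis

lemma X_nonempty: "X \<noteq> {}"
  by (rule fr_surj[of 0]) (auto simp: is_fraction_def vanishes_on_def)

lemma is_fraction_Const [simp]: "is_fraction n X (Const c) 1"
  using X_nonempty by (intro is_fractionI[of _ 0]) (auto simp: vanishes_on_def)

lemma fr_1_1: "fr 1 1 = 1"
proof -
  obtain P Q where PQ: "is_fraction n X P Q" "1 = fr P Q"
    by (rule fr_surj)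
  have "fr 1 1 * fr P Q = fr P Q"
    using fr_mult[OF is_fraction_Const[of 1] PQ(1)] by (simp add: Const_1)
  then show ?thesis
    by (simp flip: PQ(2))
qed

lemma fr_self: "homogeneous n d Q \<Longrightarrow> \<not> vanishes_on X Q \<Longrightarrow> fr Q Q = 1"
  using fr_eq_iff[OF is_fractionI is_fraction_Const[of 1], of d Q Q] fr_1_1 by (simp add: Const_1)

lemma fr_0:
  assumes "homogeneous n d Q" "\<not> vanishes_on X Q"
  shows "fr 0 Q = 0"
proof -
  have fr: "is_fraction n X 0 Q" "is_fraction n X 0 (Q * Q)" "is_fraction n X Q Q"
    using assms homogeneous_mult[OF assms(1,1)] homogeneous_0
    unfolding is_fraction_def vanishes_on_def mp_eval_mult by (metis mult_eq_0_iff)+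
  have "fr 0 Q + fr 0 Q = fr 0 (Q * Q)"
    using fr_add[OF fr(1) fr(1)] by simp
  also have "\<dots> = fr 0 Q"
    using fr_eq_iff[OF fr(2,1)] by simp
  finally show ?thesis
    by (simp only: add_cancel_left_right)
qed

text \<open>The coordinate ring has no zero divisors. If \<open>Q Q'\<close> vanished on \<open>X\<close>, then
  \<open>S = Q + Q'\<close> would not, since where \<open>Q\<close> is nonzero \<open>S\<close> agrees with \<open>Q\<close>; but then
  \<open>Q/S\<close> and \<open>Q'/S\<close> would be nonzero elements of the function field with product zero.\<close>

lemma nonvanishing_mult:
  assumes "homogeneous n d Q" "homogeneous n d Q'" "\<not> vanishes_on X Q" "\<not> vanishes_on X Q'"
  shows "\<not> vanishes_on X (Q * Q')"
proof
  assume van: "vanishes_on X (Q * Q')"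
  define S where "S = Q + Q'"
  have z: "mp_eval x Q = 0 \<or> mp_eval x Q' = 0" if "x \<in> X" for x
    using van that by (auto simp: vanishes_on_def mp_eval_mult)
  have hom: "homogeneous n d S"
    using assms by (simp add: S_def homogeneous_add)
  obtain x x' where x: "x \<in> X" "mp_eval x Q \<noteq> 0" and x': "x' \<in> X" "mp_eval x' Q' \<noteq> 0"
    using assms by (auto simp: vanishes_on_def)
  have Sx: "mp_eval x S = mp_eval x Q" and Sx': "mp_eval x' S = mp_eval x' Q'"
    using z[OF x(1)] z[OF x'(1)] x x' by (auto simp: S_def mp_eval_add)
  have nS: "\<not> vanishes_on X S"
    using x Sx unfolding vanishes_on_def by metis
  note fr = is_fractionI[OF assms(1) hom nS] is_fractionI[OF assms(2) hom nS]
    is_fractionI[OF homogeneous_0 hom nS]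
  have hom2: "homogeneous n (d + d) (S * S)" "homogeneous n (d + d) (Q * Q')"
    using assms hom by (auto intro: homogeneous_mult)
  have nS2: "\<not> vanishes_on X (S * S)"
    using x Sx unfolding vanishes_on_def mp_eval_mult by (metis mult_eq_0_iff)
  have "fr Q S * fr Q' S = fr (Q * Q') (S * S)"
    by (rule fr_mult[OF fr(1,2)])
  also have "\<dots> = fr 0 S"
    using z fr_eq_iff[OF is_fractionI[OF hom2(2,1) nS2] fr(3)] by (auto simp: mp_eval_mult)
  also have "\<dots> = 0"
    using fr_0[OF hom nS] .
  finally have "fr Q S = fr 0 S \<or> fr Q' S = fr 0 S"
    by (simp add: fr_0[OF hom nS])
  then show False
    using fr_eq_iff[OF fr(1,3)] fr_eq_iff[OF fr(2,3)] x x' Sx Sx' by fastforce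
qed

text \<open>Fractions can be rewritten over a common denominator of the same degree. This turns every
  fraction into a quotient of two dehomogenised polynomials.\<close>

lemma fr_quotient:
  assumes "homogeneous n d P" "homogeneous n d Q" "homogeneous n d R"
    and "\<not> vanishes_on X Q" "\<not> vanishes_on X R"
  shows "fr P Q = fr P R / fr Q R" "fr Q R \<noteq> 0"
proof -
  have QR: "is_fraction n X Q R" "is_fraction n X R Q" "is_fraction n X P Q" "is_fraction n X P R"
    using assms by (auto intro: is_fractionI)
  have nonvan: "\<not> vanishes_on X (Q * R)" "\<not> vanishes_on X (R * Q)"
    using nonvanishing_mult assms by blast+
  have hom: "homogeneous n (d + d) (Q * R)" "homogeneous n (d + d) (P * Q)"
    using assms by (auto intro: homogeneous_mult)
  have "fr Q R * fr R Q = fr (Q * R) (R * Q)"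
    using QR by (intro fr_mult)
  also have "\<dots> = 1"
    using fr_self[OF hom(1) nonvan(1)] by (simp add: mult.commute)
  finally show *: "fr Q R \<noteq> 0"
    by auto
  have "fr P Q * fr Q R = fr (P * Q) (Q * R)"
    using QR by (intro fr_mult)
  also have "\<dots> = fr P R"
    using fr_eq_iff[OF is_fractionI[OF hom(2,1) nonvan(1)] QR(4)] by (simp add: mp_eval_mult)
  finally show "fr P Q = fr P R / fr Q R"
    using * by (simp add: field_simps)
qed

lemma fr_add_same:
  assumes "homogeneous n d P" "homogeneous n d P'" "homogeneous n d Q" "\<not> vanishes_on X Q"
  shows "fr (P + P') Q = fr P Q + fr P' Q"
proof -
  have "\<not> vanishes_on X (Q * Q)"
    using assms(4) by (auto simp: vanishes_on_def mp_eval_mult)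
  moreover have "homogeneous n (d + d) (Q * Q)" "homogeneous n (d + d) (P * Q + P' * Q)"
    using assms by (auto intro: homogeneous_mult homogeneous_add)
  ultimately have "fr (P * Q + P' * Q) (Q * Q) = fr (P + P') Q"
    using assms
    by (subst fr_eq_iff)
      (auto intro: is_fractionI homogeneous_add simp: mp_eval_add mp_eval_mult algebra_simps)
  then show ?thesis
    using fr_add[of P Q P' Q] assms by (auto simp: is_fractionI)
qed

subsection \<open>Constants\<close>

lemma const_fun_0 [simp]: "const_fun fr 0 = 0"
  using fr_0[of 0 1] X_nonempty by (auto simp: const_fun_def Const_def vanishes_on_def)

lemma const_fun_1 [simp]: "const_fun fr 1 = 1"
  by (simp add: const_fun_def Const_1 fr_1_1)

lemma const_fun_add: "const_fun fr (a + b) = const_fun fr a + const_fun fr b"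
  using fr_add[OF is_fraction_Const is_fraction_Const, of a b]
  by (simp add: const_fun_def Const_def single_add)

lemma const_fun_mult: "const_fun fr (a * b) = const_fun fr a * const_fun fr b"
  using fr_mult[OF is_fraction_Const is_fraction_Const, of a b]
  by (simp add: const_fun_def Const_def mult_single)

lemma const_fun_power: "const_fun fr (a ^ e) = const_fun fr a ^ e"
  by (induction e) (auto simp: const_fun_mult)

lemma const_fun_sum: "const_fun fr (sum f I) = (\<Sum>i\<in>I. const_fun fr (f i))"
  by (induction I rule: infinite_finite_induct) (auto simp: const_fun_add)

lemma const_fun_prod: "const_fun fr (prod f I) = (\<Prod>i\<in>I. const_fun fr (f i))"
  by (induction I rule: infinite_finite_induct) (auto simp: const_fun_mult)

subsection \<open>Regular functions\<close>

lemma regular_1: "x \<in> X \<Longrightarrow> regular_at n X fr x 1"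
  unfolding regular_at_def using is_fraction_Const[of 1] fr_1_1
  by (intro exI[of _ 1]) (auto simp: Const_1)

lemma regular_mult:
  assumes "x \<in> X" "regular_at n X fr x f" "regular_at n X fr x g"
  shows "regular_at n X fr x (f * g)"
proof -
  obtain P Q P' Q' where
    PQ: "is_fraction n X P Q" "mp_eval x Q \<noteq> 0" "f = fr P Q" and
    PQ': "is_fraction n X P' Q'" "mp_eval x Q' \<noteq> 0" "g = fr P' Q'"
    using assms by (auto simp: regular_at_def)
  have nz: "mp_eval x (Q * Q') \<noteq> 0"
    using PQ PQ' by (simp add: mp_eval_mult)
  then have "\<not> vanishes_on X (Q * Q')"
    using assms(1) by (auto simp: vanishes_on_def)
  then have "is_fraction n X (P * P') (Q * Q')"
    using PQ(1) PQ'(1) by (auto simp: is_fraction_def intro: homogeneous_mult)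
  moreover have "f * g = fr (P * P') (Q * Q')"
    using PQ PQ' fr_mult by simp
  ultimately show ?thesis
    using nz unfolding regular_at_def by blast
qed

lemma regular_power:
  "x \<in> X \<Longrightarrow> regular_at n X fr x f \<Longrightarrow> regular_at n X fr x (f ^ e)"
  by (induction e) (auto intro: regular_1 regular_mult)

lemma regular_prod:
  "x \<in> X \<Longrightarrow> (\<And>i. i \<in> I \<Longrightarrow> regular_at n X fr x (f i)) \<Longrightarrow> regular_at n X fr x (prod f I)"
  by (induction I rule: infinite_finite_induct) (auto intro: regular_1 regular_mult)

lemma regular_Var_quotient:
  assumes "x \<in> X" "x i \<noteq> 0" "i \<in> {1..n+1}" "j \<in> {1..n+1}"
  shows "regular_at n X fr x (fr (Var j) (Var i))"
  using assms unfolding regular_at_def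
  by (intro exI[of _ "Var j"] exI[of _ "Var i"])
    (auto simp: vanishes_on_def intro!: is_fractionI[of _ 1] homogeneous_Var[unfolded One_nat_def])

lemma form_regularI:
  assumes "regular_at n X fr x f" "regular_at n X fr x g" "\<omega> = f \<cdot>\<^sub>\<Omega> diff fr g"
  shows "form_regular_at n X fr x \<omega>"
  unfolding form_regular_at_def using assms
  by (intro exI[of _ 1] exI[of _ "\<lambda>_. f"] exI[of _ "\<lambda>_. g"]) auto

subsection \<open>Derivations\<close>

lemma derivation_rules:
  assumes "is_derivation fr D"
  shows "D (f + g) = D f + D g" "D (f * g) = f * D g + g * D f" "D (const_fun fr c) = 0"
    "D 1 = 0" "D (f ^ e) = of_nat e * f ^ (e - 1) * D f"
proof -
  show add: "D (f + g) = D f + D g" and mult: "D (f * g) = f * D g + g * D f"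
    and c: "D (const_fun fr c) = 0" for f g c
    using assms by (auto simp: is_derivation_def)
  show 1: "D 1 = 0"
    using c[of 1] by simp
  show "D (f ^ e) = of_nat e * f ^ (e - 1) * D f"
  proof (induction e)
    case (Suc e)
    then show ?case
      by (cases e) (auto simp: mult algebra_simps)
  qed (simp add: 1)
qed

end

section \<open>The curve and its coordinate functions\<close>

lemma curve_iff:
  assumes "n \<ge> 2"
  shows "x \<in> curve k n lam \<longleftrightarrow> (\<exists>i\<in>{1..n+1}. x i \<noteq> 0) \<and>
    (\<forall>j\<in>{3..n+1}. delta lam j * x 1 ^ k + x 2 ^ k + x j ^ k = 0)"
proof -
  have J: "{3..n+1} = insert 3 ((\<lambda>j. j + 3) ` {1..n-2})"
    using assms by auto
  show ?thesis
    unfolding J curve_def delta_def ball_simps by simp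
qed

lemma sqrt_char2:
  fixes c :: "'a::alg_closed_field"
  assumes "CHAR('a) = 2"
  shows "sqrt_char2 c ^ 2 = c"
proof -
  have "(2 :: 'a) = 0"
    using of_nat_CHAR[where 'a = 'a] assms by simp
  then have two: "u + u = 0" for u :: 'a
    by (metis mult_2 mult_zero_left)
  obtain b where b: "b ^ 2 = c"
    using nth_root_exists[of 2 c] by auto
  have "b' = b" if "b' ^ 2 = c" for b'
  proof -
    have "(b' + b) ^ 2 = (b' ^ 2 + b ^ 2) + (b' * b + b' * b)"
      by (simp add: power2_eq_square algebra_simps)
    also have "\<dots> = 0"
      by (simp only: that b two add_0_left)
    finally have "b' + b = 0"
      by simp
    then show ?thesis
      using two[of b] add_right_cancel[of b' b b] by simp
  qed
  with b show ?thesis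
    unfolding sqrt_char2_def by (intro theI[of "\<lambda>b. b ^ 2 = c"])
qed

locale char2_curve =
  function_field n "curve k n lam" fr
  for n k :: nat and lam :: "nat \<Rightarrow> 'a::alg_closed_field"
    and fr :: "'a mpol \<Rightarrow> 'a mpol \<Rightarrow> 'f::field" +
  assumes char2: "CHAR('a) = 2"
    and odd_k: "odd k" and n_ge_2: "n \<ge> 2"
    and lam_ne: "\<And>j. j \<in> {1..n-2} \<Longrightarrow> lam j \<noteq> 0 \<and> lam j \<noteq> 1"
    and inj_lam: "inj_on lam {1..n-2}"
begin

abbreviation X where "X \<equiv> curve k n lam"
abbreviation y where "y \<equiv> coord fr"
abbreviation z where "z \<equiv> coord fr 2"
abbreviation \<kappa> where "\<kappa> \<equiv> const_fun fr"
abbreviation \<delta> where "\<delta> \<equiv> delta lam"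

lemma k_pos: "k > 0"
  using odd_k by (cases k) auto

lemma two_eq_0: "(2 :: 'a) = 0" and two_eq_0': "(2 :: 'f) = 0"
proof -
  show *: "(2 :: 'a) = 0"
    using of_nat_CHAR[where 'a = 'a] char2 by simp
  have "(2 :: 'f) = \<kappa> 1 + \<kappa> 1"
    by simp
  also have "\<dots> = \<kappa> (1 + 1)"
    by (rule const_fun_add[symmetric])
  finally show "(2 :: 'f) = 0"
    by (simp add: *)
qed

lemma add_self [simp]: "(u :: 'a) + u = 0" "(v :: 'f) + v = 0"
  using mult_2[of u] mult_2[of v] by (simp_all add: two_eq_0 two_eq_0')

lemma add_eq_0_iff_char2: "(u :: 'a) + v = 0 \<longleftrightarrow> u = v" "(f :: 'f) + g = 0 \<longleftrightarrow> f = g"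
  using add_right_cancel[of u v v] add_right_cancel[of f g g] by simp_all

lemma power2_add_char2: "((f :: 'f) + g) ^ 2 = f ^ 2 + g ^ 2"
  by (simp add: power2_sum two_eq_0')

lemma power2_sum_char2: "(sum f I :: 'f) ^ 2 = (\<Sum>i\<in>I. f i ^ 2)"
  by (induction I rule: infinite_finite_induct) (auto simp: power2_add_char2)

lemma of_nat_char2: "(of_nat m :: 'f) = (if even m then 0 else 1)"
  by (induction m) auto

lemma delta_ne_0:
  assumes "j \<in> {3..n+1}"
  shows "\<delta> j \<noteq> 0"
proof -
  have "j = 3 \<or> j - 3 \<in> {1..n-2}"
    using assms by auto
  then show ?thesis
    using lam_ne by (auto simp: delta_def)
qed

lemma delta_inj:
  assumes "i \<in> {3..n+1}" "j \<in> {3..n+1}" "\<delta> i = \<delta> j"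
  shows "i = j"
proof -
  have 1: "l - 3 \<in> {1..n-2}" if "l \<in> {3..n+1}" "l \<noteq> 3" for l
    using that by auto
  show ?thesis
  proof (cases "i = 3 \<or> j = 3")
    case True
    then show ?thesis
      using assms lam_ne[OF 1, of i] lam_ne[OF 1, of j] by (auto simp: delta_def split: if_splits)
  next
    case False
    then have "lam (i - 3) = lam (j - 3)"
      using assms by (simp add: delta_def)
    then have "i - 3 = j - 3"
      using 1[of i] 1[of j] assms False by (intro inj_onD[OF inj_lam]) auto
    then show ?thesis
      using assms by auto
  qed
qed

lemma curve_eq:
  assumes "x \<in> X" "j \<in> {3..n+1}"
  shows "x j ^ k = x 2 ^ k + \<delta> j * x 1 ^ k"
proof -
  have "\<delta> j * x 1 ^ k + x 2 ^ k + x j ^ k = 0"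
    using assms curve_iff[OF n_ge_2] by blast
  then show ?thesis
    unfolding add_eq_0_iff_char2 by (simp add: add_ac)
qed

lemma Var_nonvanishing:
  assumes "i \<in> {1..n+1}"
  shows "\<not> vanishes_on X (Var i)"
proof (cases "i = 1")
  case True
  define x where "x i = (if i \<le> 2 then 1 else (SOME v. v ^ k = 1 + \<delta> i))" for i
  have ex: "\<exists>v. v ^ k = u" for u :: 'a
    using nth_root_exists[OF k_pos] by metis
  have x: "x j ^ k = 1 + \<delta> j" if "j \<ge> 3" for j
    using that someI_ex[OF ex[of "1 + \<delta> j"]] by (simp add: x_def)
  have x12: "x 1 = 1" "x 2 = 1"
    by (auto simp: x_def)
  have "\<exists>i\<in>{1..n+1}. x i \<noteq> 0"
    using x12 by (intro bexI[of _ 1]) auto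
  moreover have "\<delta> j * x 1 ^ k + x 2 ^ k + x j ^ k = 0" if "j \<in> {3..n+1}" for j
    using x[of j] that unfolding add_eq_0_iff_char2 x12 by (simp add: add_ac)
  ultimately have "x \<in> X"
    unfolding curve_iff[OF n_ge_2] by blast
  moreover have "mp_eval x (Var i) \<noteq> 0"
    using True x12 by simp
  ultimately show ?thesis
    unfolding vanishes_on_def by blast
next
  case False
  \<comment> \<open>The equations hold at \<open>0 : 1 : \<dots> : 1\<close> because \<open>1 + 1 = 0\<close>.\<close>
  define x where "x i = (if i = 1 then 0 else 1 :: 'a)" for i :: nat
  have "x \<in> X"
    using n_ge_2 k_pos
    by (auto simp: curve_iff[OF n_ge_2] x_def two_eq_0 power_0_left intro!: bexI[of _ 2])
  moreover have "mp_eval x (Var i) \<noteq> 0"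
    using False by (simp add: x_def)
  ultimately show ?thesis
    unfolding vanishes_on_def by blast
qed

lemma Var_power_nonvanishing: "i \<in> {1..n+1} \<Longrightarrow> \<not> vanishes_on X (Var i ^ d)"
  using Var_nonvanishing[of i] by (auto simp: vanishes_on_def mp_eval_power)

lemma is_fraction_Var:
  "i \<in> {1..n+1} \<Longrightarrow> j \<in> {1..n+1} \<Longrightarrow> is_fraction n X (Var j) (Var i)"
  using homogeneous_Var Var_nonvanishing by (blast intro: is_fractionI)

lemma coord_ne_0: "i \<in> {1..n+1} \<Longrightarrow> y i \<noteq> 0"
  unfolding coord_def
  by (rule fr_quotient(2)[of 1 "Var 1" "Var i" "Var 1"])
    (auto intro!: homogeneous_Var[unfolded One_nat_def] Var_nonvanishing)

lemma fr_Var: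
  "i \<in> {1..n+1} \<Longrightarrow> j \<in> {1..n+1} \<Longrightarrow> fr (Var j) (Var i) = y j / y i"
  unfolding coord_def
  by (rule fr_quotient(1)[of 1 "Var j" "Var i" "Var 1"])
    (auto intro!: homogeneous_Var[unfolded One_nat_def] Var_nonvanishing)

lemma coord_1: "y 1 = 1"
  using fr_self[OF homogeneous_Var Var_nonvanishing, of 1] by (simp add: coord_def)

lemma coord_power: "i \<in> {1..n+1} \<Longrightarrow> y i ^ d = fr (Var i ^ d) (Var 1 ^ d)"
proof (induction d)
  case 0
  then show ?case by (simp add: fr_1_1)
next
  case (Suc d)
  have "is_fraction n X (Var i ^ d) (Var 1 ^ d)"
    using Suc.prems homogeneous_Var_power Var_power_nonvanishing
    by (intro is_fractionI[of _ d]) auto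
  then show ?case
    using Suc fr_mult[OF is_fraction_Var[of 1 i]] by (simp add: coord_def)
qed

text \<open>The affine equations: in characteristic 2 signs disappear.\<close>

lemma coord_relation:
  assumes j: "j \<in> {3..n+1}"
  shows "y j ^ k = z ^ k + \<kappa> (\<delta> j)"
proof -
  have 12: "1 \<in> {1..n+1}" "2 \<in> {1..n+1}" "j \<in> {1..n+1}"
    using j by auto
  note nonvan = Var_power_nonvanishing[OF 12(1), of k]
  note hom = homogeneous_Var_power[where 'a = 'a and n = n and d = k]
  have hom': "homogeneous n k (Const (\<delta> j) * Var 1 ^ k)"
    using homogeneous_mult[OF homogeneous_Const hom[OF 12(1)]] by simp
  have frac: "is_fraction n X (Const (\<delta> j) * Var 1 ^ k) (Var 1 ^ k)"
    "is_fraction n X (Var j ^ k) (Var 1 ^ k)"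
    "is_fraction n X (Var 2 ^ k + Const (\<delta> j) * Var 1 ^ k) (Var 1 ^ k)"
    using hom[OF 12(1)] hom[OF 12(2)] hom[OF 12(3)] hom' nonvan
    by (blast intro: is_fractionI homogeneous_add)+
  have "y j ^ k = fr (Var j ^ k) (Var 1 ^ k)"
    by (rule coord_power[OF 12(3)])
  also have "\<dots> = fr (Var 2 ^ k + Const (\<delta> j) * Var 1 ^ k) (Var 1 ^ k)"
    using curve_eq[OF _ j]
    by (subst fr_eq_iff[OF frac(2,3)]) (simp add: mp_eval_add mp_eval_mult mp_eval_power)
  also have "\<dots> = fr (Var 2 ^ k) (Var 1 ^ k) + fr (Const (\<delta> j) * Var 1 ^ k) (Var 1 ^ k)"
    by (rule fr_add_same[OF hom[OF 12(2)] hom' hom[OF 12(1)] nonvan])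
  also have "fr (Const (\<delta> j) * Var 1 ^ k) (Var 1 ^ k) = \<kappa> (\<delta> j)"
    unfolding const_fun_def
    by (subst fr_eq_iff[OF frac(1) is_fraction_Const]) (simp add: mp_eval_mult)
  also have "fr (Var 2 ^ k) (Var 1 ^ k) = z ^ k"
    by (rule coord_power[OF 12(2), symmetric])
  finally show ?thesis .
qed

section \<open>Regularity of the forms\<close>

text \<open>This is the derivative of \<open>y\<^sub>j\<^sup>k = z\<^sup>k + \<delta>\<^sub>j\<close>; the factor \<open>k\<close> is \<open>1\<close> in characteristic 2.\<close>

lemma diff_z_eq:
  assumes "j \<in> {3..n+1}"
  shows "diff fr z = (y j / z) ^ (k - 1) \<cdot>\<^sub>\<Omega> diff fr (y j)"
proof
  fix D
  have z: "z \<noteq> 0"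
    using coord_ne_0[of 2] n_ge_2 by simp
  show "diff fr z D = ((y j / z) ^ (k - 1) \<cdot>\<^sub>\<Omega> diff fr (y j)) D"
  proof (cases "is_derivation fr D")
    case True
    note D = derivation_rules[OF True]
    have "D (y j ^ k) = D (z ^ k)"
      by (simp add: coord_relation[OF assms] D(1,3))
    then have "y j ^ (k - 1) * D (y j) = z ^ (k - 1) * D z"
      using odd_k by (simp add: D(5) of_nat_char2)
    then show ?thesis
      using True z by (simp add: diff_def scale_def power_divide field_simps)
  qed (simp add: diff_def scale_def)
qed

lemma theta_of_nat:
  "theta n fr (int e) \<alpha> = (z ^ e / (\<Prod>j\<in>{3..n+1}. y j ^ \<alpha> j)) \<cdot>\<^sub>\<Omega> diff fr z"
  by (simp add: theta_def)

lemma scale_scale: "f \<cdot>\<^sub>\<Omega> g \<cdot>\<^sub>\<Omega> \<omega> = (f * g) \<cdot>\<^sub>\<Omega> \<omega>"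
  by (simp add: scale_def mult.assoc)

lemma regular_coord_quotient:
  assumes "x \<in> X" "x i \<noteq> 0" "i \<in> {1..n+1}" "j \<in> {1..n+1}"
  shows "regular_at n X fr x (y j / y i)"
  using regular_Var_quotient[OF assms] fr_Var[OF assms(3,4)] by simp

lemma theta_regular_affine:
  assumes x: "x \<in> X" "x 1 \<noteq> 0" and nz: "\<And>j. j \<in> {3..n+1} \<Longrightarrow> x j \<noteq> 0"
  shows "form_regular_at n X fr x (theta n fr (int e) \<alpha>)"
proof -
  have z: "regular_at n X fr x z"
    using regular_coord_quotient[OF x, of 2] coord_1 n_ge_2 by simp
  have "regular_at n X fr x (1 / y j)" if "j \<in> {3..n+1}" for j
    using regular_coord_quotient[OF x(1) nz[OF that], of 1] that coord_1 by simp
  then have "regular_at n X fr x (z ^ e * (\<Prod>j\<in>{3..n+1}. (1 / y j) ^ \<alpha> j))"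
    by (intro regular_mult regular_power regular_prod x z)
  moreover have "theta n fr (int e) \<alpha> = (z ^ e * (\<Prod>j\<in>{3..n+1}. (1 / y j) ^ \<alpha> j)) \<cdot>\<^sub>\<Omega> diff fr z"
    by (simp add: theta_of_nat power_one_over prod_dividef)
  ultimately show ?thesis
    using z by (intro form_regularI)
qed

text \<open>At a point off the hyperplane \<open>x\<^sub>1 = 0\<close> where \<open>y\<^sub>j\<close> vanishes, neither \<open>z\<close> nor any other
  \<open>y\<^sub>i\<close> does, because the \<open>\<delta>\<close>s are distinct and nonzero. In terms of \<open>dy\<^sub>j\<close> the form acquires the
  factor \<open>(y\<^sub>j/z)\<^bsup>k-1\<^esup>\<close>, whose zero of order \<open>k - 1\<close> absorbs the pole from \<open>y\<^sub>j\<^bsup>\<alpha>\<^sub>j\<^esup>\<close>.\<close>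

lemma theta_regular_branch:
  assumes x: "x \<in> X" "x 1 \<noteq> 0" and j: "j \<in> {3..n+1}" "x j = 0"
    and \<alpha>: "\<alpha> j \<le> k - 1"
  shows "form_regular_at n X fr x (theta n fr (int e) \<alpha>)"
proof -
  have r2: "x 2 ^ k = \<delta> j * x 1 ^ k"
    using curve_eq[OF x(1) j(1)] j(2) k_pos
    by (metis add_eq_0_iff_char2(1) power_eq_0_iff)
  have nz2: "x 2 \<noteq> 0"
    using r2 delta_ne_0[OF j(1)] x(2) k_pos by (auto simp: power_0_left)
  have nz: "x i \<noteq> 0" if i: "i \<in> {3..n+1} - {j}" for i
  proof
    assume "x i = 0"
    then have "x 2 ^ k = \<delta> i * x 1 ^ k"
      using curve_eq[OF x(1), of i] i k_pos
      by (metis DiffD1 add_eq_0_iff_char2(1) power_eq_0_iff)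
    then show False
      using r2 x(2) delta_inj[of i j] i j by auto
  qed
  define f where "f = z ^ e * y j ^ (k - 1 - \<alpha> j) * (1 / z) ^ (k - 1) *
    (\<Prod>i\<in>{3..n+1} - {j}. (1 / y i) ^ \<alpha> i)"
  have z: "regular_at n X fr x z" and zi: "regular_at n X fr x (1 / z)"
    using regular_coord_quotient[OF x, of 2] regular_coord_quotient[OF x(1) nz2, of 1]
      coord_1 n_ge_2 by auto
  have yj: "regular_at n X fr x (y j)"
    using regular_coord_quotient[OF x, of j] coord_1 j by simp
  have yi: "regular_at n X fr x (1 / y i)" if "i \<in> {3..n+1} - {j}" for i
    using regular_coord_quotient[OF x(1) nz[OF that], of 1] that coord_1 by simp
  have reg: "regular_at n X fr x f"
    unfolding f_def by (intro regular_mult regular_power regular_prod x z zi yj yi)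
  have "(\<Prod>i\<in>{3..n+1}. y i ^ \<alpha> i) = y j ^ \<alpha> j * (\<Prod>i\<in>{3..n+1} - {j}. y i ^ \<alpha> i)"
    using j by (intro prod.remove) auto
  moreover have "y j ^ (k - 1) = y j ^ \<alpha> j * y j ^ (k - 1 - \<alpha> j)"
    using \<alpha> by (metis le_add_diff_inverse power_add)
  moreover have "y j \<noteq> 0"
    using j by (intro coord_ne_0) auto
  ultimately have "z ^ e / (\<Prod>i\<in>{3..n+1}. y i ^ \<alpha> i) * (y j / z) ^ (k - 1) = f"
    by (simp add: f_def power_divide prod_dividef)
  then have "theta n fr (int e) \<alpha> = f \<cdot>\<^sub>\<Omega> diff fr (y j)"
    by (simp only: theta_of_nat diff_z_eq[OF j(1)] scale_scale)
  with reg yj show ?thesis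
    by (rule form_regularI)
qed

text \<open>At a point with \<open>x\<^sub>1 = 0\<close> all other coordinates are nonzero. There \<open>u = 1/z\<close> is a local
  parameter and every \<open>v\<^sub>j = y\<^sub>j/z\<close> is a unit. Substituting \<open>z = 1/u\<close>, \<open>y\<^sub>j = v\<^sub>j/u\<close> and
  \<open>dz = du/u\<^sup>2\<close> multiplies the form by \<open>u\<close> to the power \<open>\<Sum>\<^sub>j \<alpha>\<^sub>j - r - 2\<close>; this is where the
  upper bound on \<open>r\<close> in the index set comes from.\<close>

lemma theta_regular_infinity:
  assumes x: "x \<in> X" "x 1 = 0" and e: "e + 2 \<le> (\<Sum>j\<in>{3..n+1}. \<alpha> j)"
  shows "form_regular_at n X fr x (theta n fr (int e) \<alpha>)"
proof -
  have same: "x j ^ k = x 2 ^ k" if "j \<in> {3..n+1}" for j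
    using curve_eq[OF x(1) that] x(2) k_pos by (simp add: power_0_left)
  have nz2: "x 2 \<noteq> 0"
  proof
    assume "x 2 = 0"
    then have "x j = 0" if "j \<in> {1..n+1}" for j
    proof -
      have "j = 1 \<or> j = 2 \<or> j \<in> {3..n+1}"
        using that by auto
      then show ?thesis
        using same[of j] x(2) k_pos \<open>x 2 = 0\<close> by (auto simp: power_0_left)
    qed
    then show False
      using x(1) curve_iff[OF n_ge_2] by blast
  qed
  have nz: "x j \<noteq> 0" if "j \<in> {3..n+1}" for j
    using same[OF that] nz2 k_pos by (metis power_eq_0_iff)
  define u where "u = 1 / z"
  define s where "s = (\<Sum>j\<in>{3..n+1}. \<alpha> j)"
  define f where "f = u ^ (s - e - 2) * (\<Prod>j\<in>{3..n+1}. (z / y j) ^ \<alpha> j)"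
  have z: "z \<noteq> 0"
    using coord_ne_0[of 2] n_ge_2 by simp
  have u: "regular_at n X fr x u"
    using regular_coord_quotient[OF x(1) nz2, of 1] coord_1 n_ge_2 by (simp add: u_def)
  have v: "regular_at n X fr x (z / y j)" if "j \<in> {3..n+1}" for j
    using regular_coord_quotient[OF x(1) nz[OF that], of 2] that by simp
  have reg: "regular_at n X fr x f"
    unfolding f_def by (intro regular_mult regular_power regular_prod x u v)
  have "(\<Prod>j\<in>{3..n+1}. (z / y j) ^ \<alpha> j) = z ^ s / (\<Prod>j\<in>{3..n+1}. y j ^ \<alpha> j)"
    by (simp only: power_divide prod_dividef s_def power_sum)
  moreover have "z ^ s = z ^ (s - e - 2) * z ^ (e + 2)"
  proof -
    have "s = (s - e - 2) + (e + 2)"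
      using e unfolding s_def by linarith
    then show ?thesis
      by (metis power_add)
  qed
  moreover have "u ^ (s - e - 2) * z ^ (s - e - 2) = 1"
    using z by (simp add: u_def flip: power_mult_distrib)
  ultimately have f: "f = z ^ e / (\<Prod>j\<in>{3..n+1}. y j ^ \<alpha> j) * z ^ 2"
    unfolding f_def by (simp only: power_add times_divide_eq_right times_divide_eq_left
        mult.assoc[symmetric] mult_1_left)
  have "diff fr z = z ^ 2 \<cdot>\<^sub>\<Omega> diff fr u"
  proof
    fix D
    show "diff fr z D = (z ^ 2 \<cdot>\<^sub>\<Omega> diff fr u) D"
    proof (cases "is_derivation fr D")
      case True
      note D = derivation_rules[OF True]
      have "D (z * u) = 0"
        using z D(4) by (simp add: u_def)
      then have "z * D u = u * D z"
        unfolding D(2) add_eq_0_iff_char2 .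
      then have "z * (z * D u) = D z"
        using z by (simp add: u_def)
      then show ?thesis
        using True by (simp add: diff_def scale_def power2_eq_square mult.assoc)
    qed (simp add: diff_def scale_def)
  qed
  then have "theta n fr (int e) \<alpha> = f \<cdot>\<^sub>\<Omega> diff fr u"
    by (simp only: theta_of_nat f scale_scale)
  with reg u show ?thesis
    by (rule form_regularI)
qed

lemma theta_holomorphic:
  assumes "\<And>j. j \<in> {3..n+1} \<Longrightarrow> \<alpha> j \<le> k - 1" "e + 2 \<le> (\<Sum>j\<in>{3..n+1}. \<alpha> j)"
  shows "theta n fr (int e) \<alpha> \<in> H10 n X fr"
proof -
  have "form_regular_at n X fr x (theta n fr (int e) \<alpha>)" if x: "x \<in> X" for x
  proof (cases "x 1 = 0")
    case True
    then show ?thesis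
      using x assms(2) by (intro theta_regular_infinity)
  next
    case False
    show ?thesis
    proof (cases "\<exists>j\<in>{3..n+1}. x j = 0")
      case True
      then obtain j where "j \<in> {3..n+1}" "x j = 0"
        by blast
      then show ?thesis
        using x False assms(1) by (intro theta_regular_branch)
    next
      case nonzero: False
      then show ?thesis
        using x False by (intro theta_regular_affine) auto
    qed
  qed
  then show ?thesis
    by (simp add: H10_def)
qed

section \<open>The function field as a plane over its squares\<close>

text \<open>In the coordinates \<open>a, b\<close> the Cartier operator reads \<open>(a\<^sup>2 + b\<^sup>2 z) dz \<mapsto> b dz\<close>.\<close>

definition square_plane :: "'f set" where
  "square_plane = {a ^ 2 + b ^ 2 * z | a b. True}"

lemma square_planeI: "f = a ^ 2 + b ^ 2 * z \<Longrightarrow> f \<in> square_plane"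
  by (auto simp: square_plane_def)

lemma square_in_plane: "a ^ 2 \<in> square_plane"
  by (rule square_planeI[of _ a 0]) simp

lemma square_plane_1: "1 \<in> square_plane"
  using square_in_plane[of 1] by simp

lemma square_plane_add:
  assumes "f \<in> square_plane" "g \<in> square_plane"
  shows "f + g \<in> square_plane"
proof -
  from assms obtain a b c d where "f = a ^ 2 + b ^ 2 * z" "g = c ^ 2 + d ^ 2 * z"
    by (auto simp: square_plane_def)
  then have "f + g = (a + c) ^ 2 + (b + d) ^ 2 * z"
    by (simp add: power2_add_char2 algebra_simps)
  then show ?thesis
    by (rule square_planeI)
qed

lemma square_plane_mult:
  assumes "f \<in> square_plane" "g \<in> square_plane"
  shows "f * g \<in> square_plane"
proof -
  from assms obtain a b c d where "f = a ^ 2 + b ^ 2 * z" "g = c ^ 2 + d ^ 2 * z"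
    by (auto simp: square_plane_def)
  then have "f * g = (a * c + b * d * z) ^ 2 + (a * d + b * c) ^ 2 * z"
    unfolding power2_add_char2 by (simp add: power2_eq_square algebra_simps)
  then show ?thesis
    by (rule square_planeI)
qed

lemma square_plane_power: "f \<in> square_plane \<Longrightarrow> f ^ e \<in> square_plane"
  by (induction e) (auto intro: square_plane_1 square_plane_mult)

lemma square_plane_inverse:
  assumes "f \<in> square_plane"
  shows "inverse f \<in> square_plane"
proof -
  have "inverse f = f * (inverse f) ^ 2"
    by (cases "f = 0") (auto simp: power2_eq_square)
  then show ?thesis
    using square_plane_mult[OF assms square_in_plane] by metis
qed

lemma square_plane_divide:
  "f \<in> square_plane \<Longrightarrow> g \<in> square_plane \<Longrightarrow> f / g \<in> square_plane"
  unfolding divide_inverse by (intro square_plane_mult square_plane_inverse)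

lemma const_sqrt: "\<kappa> (sqrt_char2 c) ^ 2 = \<kappa> c"
  by (simp add: sqrt_char2[OF char2] flip: const_fun_power)

lemma square_plane_const: "\<kappa> c \<in> square_plane"
  using square_in_plane by (metis const_sqrt)

lemma square_plane_z: "z \<in> square_plane"
  by (rule square_planeI[of _ 0 1]) simp

text \<open>Since \<open>k\<close> is odd, \<open>y\<^sub>j\<close> is the square \<open>y\<^sub>j\<^bsup>k+1\<^esup>\<close> divided by the polynomial
  \<open>y\<^sub>j\<^sup>k\<close> in \<open>z\<close>.\<close>

lemma square_plane_coord:
  assumes "j \<in> {1..n+1}"
  shows "y j \<in> square_plane"
proof -
  consider "j = 1" | "j = 2" | "j \<in> {3..n+1}"
    using assms by fastforce
  then show ?thesis
  proof cases
    case 1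
    then show ?thesis
      using coord_1 square_plane_1 by simp
  next
    case 2
    then show ?thesis
      using square_plane_z by simp
  next
    case 3
    have "(k + 1) div 2 * 2 = Suc k"
      using odd_k by presburger
    then have "y j * y j ^ k = (y j ^ ((k + 1) div 2)) ^ 2"
      by (simp only: power_mult[symmetric] power_Suc[symmetric])
    then have "y j = (y j ^ ((k + 1) div 2)) ^ 2 / y j ^ k"
      using coord_ne_0[OF assms] by (metis nonzero_mult_div_cancel_right power_not_zero)
    also have "\<dots> \<in> square_plane"
      unfolding coord_relation[OF 3]
      by (intro square_plane_divide square_in_plane square_plane_add square_plane_const
          square_plane_power square_plane_z)
    finally show ?thesis .
  qed
qed

text \<open>Dehomogenised monomials are products of the \<open>y\<^sub>i\<close>.\<close>

lemma square_plane_monomial: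
  assumes "Poly_Mapping.keys m \<subseteq> {1..n+1}" "monomial_degree m = d"
  shows "fr (Poly_Mapping.single m c) (Var 1 ^ d) \<in> square_plane"
  using assms
proof (induction d arbitrary: m)
  case 0
  then have "m = 0"
    by (auto simp: monomial_degree_def intro!: poly_mapping_eqI simp: not_in_keys_iff_lookup_eq_zero)
  then show ?case
    using square_plane_const[of c] by (simp add: const_fun_def Const_def)
next
  case (Suc d)
  then have "Poly_Mapping.keys m \<noteq> {}"
    by (auto simp: monomial_degree_def)
  then obtain i where i: "i \<in> Poly_Mapping.keys m"
    by blast
  define m' where "m' = m - Poly_Mapping.single i 1"
  have m: "m = m' + Poly_Mapping.single i 1"
    using i by (auto simp: m'_def lookup_add lookup_minus lookup_single when_def in_keys_iff
        intro!: poly_mapping_eqI)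
  have keys: "Poly_Mapping.keys m' \<subseteq> {1..n+1}"
    using Suc.prems(1) by (auto simp: m'_def in_keys_iff lookup_minus)
  have "monomial_degree (Poly_Mapping.single i 1) = 1"
    by (simp add: monomial_degree_def)
  then have deg: "monomial_degree m' = d"
    using Suc.prems(2) monomial_degree_add[of m' "Poly_Mapping.single i 1"] m by simp
  have i': "i \<in> {1..n+1}"
    using i Suc.prems(1) by blast
  have frac: "is_fraction n X (Poly_Mapping.single m' c) (Var 1 ^ d)"
  proof (rule is_fractionI)
    show "homogeneous n d (Poly_Mapping.single m' c)"
      using keys deg by (cases "c = 0") (auto simp: homogeneous_altdef)
  qed (auto simp: homogeneous_Var_power Var_power_nonvanishing)
  have "Poly_Mapping.single m c = Poly_Mapping.single m' c * Var i"
    by (simp add: m Var_def mult_single)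
  then have "fr (Poly_Mapping.single m c) (Var 1 ^ Suc d) =
      fr (Poly_Mapping.single m' c) (Var 1 ^ d) * y i"
    using fr_mult[OF frac is_fraction_Var[of 1 i]] i' by (simp add: coord_def mult_ac)
  then show ?case
    using Suc.IH[OF keys deg] square_plane_coord[OF i'] square_plane_mult by simp
qed

lemma square_plane_dehomogenised:
  assumes "homogeneous n d P"
  shows "fr P (Var 1 ^ d) \<in> square_plane"
proof -
  let ?term = "\<lambda>m. Poly_Mapping.single m (Poly_Mapping.lookup P m)"
  have 1: "homogeneous n d (Var 1 ^ d :: 'a mpol)" "\<not> vanishes_on X (Var 1 ^ d)"
    by (auto simp: homogeneous_Var_power Var_power_nonvanishing)
  have hom: "homogeneous n d (?term m)" if "m \<in> Poly_Mapping.keys P" for m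
    using assms that by (auto simp: homogeneous_altdef)
  have "fr (\<Sum>m\<in>M. ?term m) (Var 1 ^ d) \<in> square_plane \<and> homogeneous n d (\<Sum>m\<in>M. ?term m)"
    if "finite M" "M \<subseteq> Poly_Mapping.keys P" for M
    using that
  proof (induction M rule: finite_induct)
    case empty
    then show ?case
      using fr_0[OF 1] square_in_plane[of 0] by simp
  next
    case (insert m M)
    have m: "homogeneous n d (?term m)"
      using insert.prems hom by auto
    have "fr (?term m) (Var 1 ^ d) \<in> square_plane"
      using assms insert.prems by (intro square_plane_monomial) (auto simp: homogeneous_altdef)
    then show ?case
      using insert fr_add_same[OF m _ 1] m by (auto intro: square_plane_add homogeneous_add)
  qed
  from this[of "Poly_Mapping.keys P"] show ?thesis
    by (simp flip: mpol_sum_single)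
qed

lemma square_plane_UNIV: "f \<in> square_plane"
proof -
  obtain P Q where PQ: "is_fraction n X P Q" "f = fr P Q"
    by (rule fr_surj)
  then obtain d where d: "homogeneous n d P" "homogeneous n d Q" "\<not> vanishes_on X Q"
    by (auto simp: is_fraction_def)
  have "fr P Q = fr P (Var 1 ^ d) / fr Q (Var 1 ^ d)"
    using d by (intro fr_quotient[of d]) (auto simp: homogeneous_Var_power Var_power_nonvanishing)
  then show ?thesis
    using PQ d square_plane_dehomogenised square_plane_divide by simp
qed

section \<open>The Cartier operator with respect to \<open>z\<close>\<close>

lemma diff_square_plane: "diff fr (a ^ 2 + b ^ 2 * z) = b ^ 2 \<cdot>\<^sub>\<Omega> diff fr z"
proof
  fix D
  show "diff fr (a ^ 2 + b ^ 2 * z) D = (b ^ 2 \<cdot>\<^sub>\<Omega> diff fr z) D"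
  proof (cases "is_derivation fr D")
    case True
    note D = derivation_rules[OF True]
    show ?thesis
      using True by (simp add: diff_def scale_def D(1,2,5) two_eq_0')
  qed (simp add: diff_def scale_def)
qed

lemma square_coefficients_unique:
  assumes t: "t \<notin> range (\<lambda>f. f ^ 2)" and eq: "a ^ 2 + b ^ 2 * t = c ^ 2 + d ^ 2 * (t :: 'f)"
  shows "b = d"
proof (rule ccontr)
  assume "b \<noteq> d"
  then have bd: "b + d \<noteq> 0"
    by (simp add: add_eq_0_iff_char2)
  have "(a + c) ^ 2 + (b + d) ^ 2 * t = (a ^ 2 + b ^ 2 * t) + (c ^ 2 + d ^ 2 * t)"
    by (simp add: power2_add_char2 algebra_simps)
  also have "\<dots> = 0"
    unfolding eq by (rule add_self(2))
  finally have "(a + c) ^ 2 = (b + d) ^ 2 * t"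
    by (simp only: add_eq_0_iff_char2)
  then have "t = ((a + c) / (b + d)) ^ 2"
    using bd by (simp add: power_divide)
  with t show False
    by blast
qed

lemma cartier_sum:
  "(\<Sum>i<CHAR('a). u i ^ CHAR('a) * (t :: 'f) ^ i) = u 0 ^ 2 + u 1 ^ 2 * t"
proof -
  have "{..<2 :: nat} = {0, 1}"
    by auto
  then show ?thesis
    by (simp add: char2)
qed

text \<open>Writing the non-square \<open>t\<close> of the definition as \<open>c\<^sup>2 + d\<^sup>2 z\<close> with \<open>d \<noteq> 0\<close> gives
  \<open>dt = d\<^sup>2 dz\<close>, and substituting both in \<open>(u\<^sub>0\<^sup>2 + u\<^sub>1\<^sup>2 t) dt\<close> turns the recipe for \<open>t\<close> into the one
  for \<open>z\<close>. The result is well defined: if \<open>dt \<noteq> 0\<close>, the form determines \<open>u\<^sub>1\<close> because \<open>1, t\<close> are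
  independent over the squares; if \<open>dt = 0\<close>, every candidate for the image is \<open>0\<close>.\<close>

lemma cartier_eq:
  assumes t: "t \<notin> range (\<lambda>f. f ^ CHAR('a))"
    and hol: "w \<cdot>\<^sub>\<Omega> diff fr z \<in> H10 n X fr" and w: "w = a ^ 2 + b ^ 2 * z"
  shows "cartier n X fr t (w \<cdot>\<^sub>\<Omega> diff fr z) = b \<cdot>\<^sub>\<Omega> diff fr z"
proof -
  obtain c d where cd: "t = c ^ 2 + d ^ 2 * z"
    using square_plane_UNIV[of t] by (auto simp: square_plane_def)
  have d: "d \<noteq> 0"
    using t cd by (auto simp: char2)
  have dt: "diff fr t = d ^ 2 \<cdot>\<^sub>\<Omega> diff fr z"
    unfolding cd by (rule diff_square_plane)
  \<comment> \<open>Solve \<open>t = c\<^sup>2 + d\<^sup>2 z\<close> for \<open>z\<close> and substitute in \<open>w = a\<^sup>2 + b\<^sup>2 z\<close>, \<open>dz = dt/d\<^sup>2\<close>.\<close>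
  define u where "u i = (if i = 0 then a / d + b * c / d ^ 2 else b / d ^ 2)" for i :: nat
  have z: "z = (t + c ^ 2) / d ^ 2"
  proof -
    have "t + c ^ 2 = d ^ 2 * z + (c ^ 2 + c ^ 2)"
      unfolding cd by (simp only: add_ac)
    then have "t + c ^ 2 = d ^ 2 * z"
      by (simp only: add_self add_0_right)
    then show ?thesis
      using d by simp
  qed
  have "w / d ^ 2 = u 0 ^ 2 + u 1 ^ 2 * t"
  proof -
    define q where "q = d ^ 2"
    have "w = a ^ 2 + b ^ 2 * ((t + c ^ 2) / q)"
      using w z by (simp add: q_def)
    moreover have "q \<noteq> 0"
      using d by (simp add: q_def)
    ultimately have "w / q = a ^ 2 / q + b ^ 2 * c ^ 2 / q ^ 2 + b ^ 2 / q ^ 2 * t"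
      by (simp add: power2_eq_square field_simps)
    then have "w / d ^ 2 = a ^ 2 / d ^ 2 + b ^ 2 * c ^ 2 / (d ^ 2) ^ 2 + b ^ 2 / (d ^ 2) ^ 2 * t"
      unfolding q_def .
    moreover have "u 0 ^ 2 = a ^ 2 / d ^ 2 + b ^ 2 * c ^ 2 / (d ^ 2) ^ 2"
      by (simp add: u_def power2_add_char2 power_divide power_mult_distrib)
    moreover have "u 1 ^ 2 = b ^ 2 / (d ^ 2) ^ 2"
      by (simp add: u_def power_divide)
    ultimately show ?thesis
      by simp
  qed
  then have u: "w / d ^ 2 = (\<Sum>i<CHAR('a). u i ^ CHAR('a) * t ^ i)"
    unfolding cartier_sum .
  have form: "w \<cdot>\<^sub>\<Omega> diff fr z = (w / d ^ 2) \<cdot>\<^sub>\<Omega> diff fr t"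
    using d by (simp add: dt scale_scale)
  have image: "b \<cdot>\<^sub>\<Omega> diff fr z = u (CHAR('a) - 1) \<cdot>\<^sub>\<Omega> diff fr t"
    using d by (simp add: dt scale_scale u_def char2)
  have unique: "v (CHAR('a) - 1) \<cdot>\<^sub>\<Omega> diff fr t = b \<cdot>\<^sub>\<Omega> diff fr z"
    if v: "w \<cdot>\<^sub>\<Omega> diff fr z = (\<Sum>i<CHAR('a). v i ^ CHAR('a) * t ^ i) \<cdot>\<^sub>\<Omega> diff fr t" for v
  proof
    fix D
    show "(v (CHAR('a) - 1) \<cdot>\<^sub>\<Omega> diff fr t) D = (b \<cdot>\<^sub>\<Omega> diff fr z) D"
    proof (cases "diff fr t D = 0")
      case True
      then show ?thesis
        unfolding image by (simp only: scale_def mult_zero_right)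
    next
      case False
      then have "(\<Sum>i<CHAR('a). u i ^ CHAR('a) * t ^ i) = (\<Sum>i<CHAR('a). v i ^ CHAR('a) * t ^ i)"
        using fun_cong[OF v, of D] unfolding form u by (simp add: scale_def)
      then have "u 0 ^ 2 + u 1 ^ 2 * t = v 0 ^ 2 + v 1 ^ 2 * t"
        unfolding cartier_sum .
      then have "u 1 = v 1"
        by (rule square_coefficients_unique[OF t[unfolded char2]])
      then show ?thesis
        by (simp add: image char2)
    qed
  qed
  show ?thesis
    unfolding cartier_def restrict_apply'[OF hol]
  proof (rule the_equality)
    show "\<exists>v. w \<cdot>\<^sub>\<Omega> diff fr z = (\<Sum>i<CHAR('a). v i ^ CHAR('a) * t ^ i) \<cdot>\<^sub>\<Omega> diff fr t \<and>
      b \<cdot>\<^sub>\<Omega> diff fr z = v (CHAR('a) - 1) \<cdot>\<^sub>\<Omega> diff fr t"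
      using form u image by (intro exI[of _ u]) simp
  qed (use unique in blast)
qed

end

section \<open>The image of \<open>\<theta>\<close>\<close>

lemma prod_add_esym:
  assumes "finite A"
  shows "(\<Prod>j\<in>A. c + d j) = (\<Sum>m\<le>card A. esym A d (card A - m) * c ^ m)"
proof -
  have "(\<Prod>j\<in>A. c + d j) = (\<Prod>j\<in>A. d j + c)"
    by (simp add: add.commute)
  also have "\<dots> = (\<Sum>T\<in>Pow A. (\<Prod>j\<in>T. d j) * c ^ (card A - card T))"
    using assms by (auto simp: prod_add card_Diff_subset finite_subset intro!: sum.cong)
  also have "\<dots> = (\<Sum>m\<le>card A. \<Sum>T\<in>{T\<in>Pow A. card A - card T = m}.
      (\<Prod>j\<in>T. d j) * c ^ (card A - card T))"
    using assms by (intro sum.group[symmetric]) auto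
  also have "\<dots> = (\<Sum>m\<le>card A. esym A d (card A - m) * c ^ m)"
  proof (rule sum.cong)
    fix m assume m: "m \<in> {..card A}"
    have "{T\<in>Pow A. card A - card T = m} = {T. T \<subseteq> A \<and> card T = card A - m}"
      using m card_mono[OF assms] by fastforce
    then show "(\<Sum>T\<in>{T\<in>Pow A. card A - card T = m}. (\<Prod>j\<in>T. d j) * c ^ (card A - card T)) =
        esym A d (card A - m) * c ^ m"
      using m by (auto simp: esym_def sum_distrib_right intro!: sum.cong)
  qed simp
  finally show ?thesis .
qed

lemma esym_0: "finite A \<Longrightarrow> esym A d 0 = 1"
proof -
  assume "finite A"
  then have "{T. T \<subseteq> A \<and> card T = 0} = {{}}"
    using finite_subset[of _ A] by (auto simp: card_eq_0_iff)
  then show ?thesis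
    by (simp add: esym_def)
qed

lemma esym_singleton: "esym {j} d 1 = d j"
proof -
  have "{T. T \<subseteq> {j} \<and> card T = 1} = {{j}}"
    by (auto simp: subset_singleton_iff)
  then show ?thesis
    by (simp add: esym_def)
qed

lemma sum_form_apply: "(sum \<omega> I :: 'f::field form) D = (\<Sum>i\<in>I. \<omega> i D)"
  by (induction I rule: infinite_finite_induct) auto

context char2_curve
begin

lemma const_fun_esym: "esym A (\<lambda>j. \<kappa> (d j)) m = \<kappa> (esym A d m)"
  by (simp add: esym_def const_fun_sum const_fun_prod)

text \<open>Multiplying \<open>\<Prod>\<^sub>j y\<^sub>j\<^bsup>\<alpha>\<^sub>j\<^esup>\<close> by \<open>y\<^sub>j\<^sup>k\<close> for every odd \<open>\<alpha>\<^sub>j\<close> makes all exponents even,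
  hence the whole product a square.\<close>

lemma denominator_square:
  fixes \<alpha> :: "nat \<Rightarrow> nat"
  defines "A \<equiv> odd_indices n \<alpha>"
  shows "(\<Prod>j\<in>{3..n+1}. y j ^ \<alpha> j) * (\<Prod>j\<in>A. y j ^ k) =
    (\<Prod>j\<in>{3..n+1}. y j ^ (alpha_hat k n \<alpha> j div 2)) ^ 2"
proof -
  have "(\<Prod>j\<in>A. y j ^ k) = (\<Prod>j\<in>{3..n+1}. if j \<in> A then y j ^ k else 1)"
  proof -
    have "{j\<in>{3..n+1}. j \<in> A} = A"
      by (auto simp: A_def odd_indices_def)
    then show ?thesis
      using prod.inter_filter[of "{3..n+1}" "\<lambda>j. y j ^ k" "\<lambda>j. j \<in> A"] by simp
  qed
  then have "(\<Prod>j\<in>{3..n+1}. y j ^ \<alpha> j) * (\<Prod>j\<in>A. y j ^ k) =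
      (\<Prod>j\<in>{3..n+1}. y j ^ \<alpha> j * (if j \<in> A then y j ^ k else 1))"
    by (simp only: prod.distrib)
  also have "\<dots> = (\<Prod>j\<in>{3..n+1}. (y j ^ (alpha_hat k n \<alpha> j div 2)) ^ 2)"
  proof (rule prod.cong)
    fix j assume j: "j \<in> {3..n+1}"
    have "even (alpha_hat k n \<alpha> j)"
      using j odd_k by (auto simp: alpha_hat_def odd_indices_def)
    then have "(y j ^ (alpha_hat k n \<alpha> j div 2)) ^ 2 = y j ^ alpha_hat k n \<alpha> j"
      by (simp flip: power_mult)
    then show "y j ^ \<alpha> j * (if j \<in> A then y j ^ k else 1) =
        (y j ^ (alpha_hat k n \<alpha> j div 2)) ^ 2"
      by (simp add: alpha_hat_def A_def power_add mult.commute)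
  qed simp
  finally show ?thesis
    by (simp only: prod_power_distrib)
qed

text \<open>With \<open>Y\<^sup>2\<close> the square just found, \<open>\<theta> = z\<^sup>r \<Prod>\<^sub>j (z\<^sup>k + \<delta>\<^sub>j) dz / Y\<^sup>2\<close>, the product taken
  over the odd indices. Its expansion is a combination of powers of \<open>z\<close> with square
  coefficients; the operator picks the odd powers. All the cases of the theorem are instances
  of this formula.\<close>

lemma cartier_theta:
  fixes \<alpha> :: "nat \<Rightarrow> nat" and e :: nat
  defines "A \<equiv> odd_indices n \<alpha>"
  assumes t: "t \<notin> range (\<lambda>f. f ^ CHAR('a))" and I: "(int e, \<alpha>) \<in> I_set k n"
  shows "cartier n X fr t (theta n fr (int e) \<alpha>) =
    (\<Sum>m\<in>{m\<in>{..card A}. odd (k * m + e)}.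
      \<kappa> (sqrt_char2 (esym A \<delta> (card A - m))) \<cdot>\<^sub>\<Omega>
        theta n fr (int ((k * m + e) div 2)) (\<lambda>j. alpha_hat k n \<alpha> j div 2))"
proof -
  define N where "N = card A"
  define Y where "Y = (\<Prod>j\<in>{3..n+1}. y j ^ (alpha_hat k n \<alpha> j div 2))"
  define c where "c m = \<kappa> (sqrt_char2 (esym A \<delta> (N - m)))" for m
  define Od where "Od = {m\<in>{..N}. odd (k * m + e)}"
  define Ev where "Ev = {m\<in>{..N}. even (k * m + e)}"
  define w where "w = z ^ e / (\<Prod>j\<in>{3..n+1}. y j ^ \<alpha> j)"
  define root_term where "root_term m = c m * z ^ ((k * m + e) div 2) / Y" for m
  have fin: "finite A" and AJ: "A \<subseteq> {3..n+1}"
    by (auto simp: A_def odd_indices_def)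
  have PA: "(\<Prod>j\<in>A. y j ^ k) \<noteq> 0"
    using AJ coord_ne_0 fin by (force simp: prod_zero_iff)
  have Y2: "Y ^ 2 = (\<Prod>j\<in>{3..n+1}. y j ^ \<alpha> j) * (\<Prod>j\<in>A. y j ^ k)"
    unfolding Y_def A_def by (rule denominator_square[symmetric])
  have "(\<Prod>j\<in>A. y j ^ k) = (\<Prod>j\<in>A. z ^ k + \<kappa> (\<delta> j))"
    using AJ by (intro prod.cong coord_relation) auto
  also have "\<dots> = (\<Sum>m\<le>N. c m ^ 2 * z ^ (k * m))"
    unfolding prod_add_esym[OF fin] N_def const_fun_esym c_def const_sqrt
    by (simp only: power_mult)
  finally have expansion: "(\<Prod>j\<in>A. y j ^ k) = (\<Sum>m\<le>N. c m ^ 2 * z ^ (k * m))" .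
  have even_term: "c m ^ 2 * z ^ (k * m + e) / Y ^ 2 = root_term m ^ 2" if "m \<in> Ev" for m
  proof -
    have "(k * m + e) div 2 * 2 = k * m + e"
      using that unfolding Ev_def by (intro dvd_div_mult_self) simp
    then have "z ^ (k * m + e) = (z ^ ((k * m + e) div 2)) ^ 2"
      by (metis power_mult)
    then show ?thesis
      by (simp only: root_term_def power_divide power_mult_distrib)
  qed
  have odd_term: "c m ^ 2 * z ^ (k * m + e) / Y ^ 2 = root_term m ^ 2 * z" if "m \<in> Od" for m
  proof -
    have "Suc ((k * m + e) div 2 * 2) = k * m + e"
      using that unfolding Od_def by (metis (no_types, lifting) Suc_eq_plus1 mem_Collect_eq
          mult.commute odd_two_times_div_two_succ)
    then have "z ^ (k * m + e) = (z ^ ((k * m + e) div 2)) ^ 2 * z"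
      by (metis power_Suc2 power_mult)
    then show ?thesis
      by (simp only: root_term_def power_divide power_mult_distrib
          times_divide_eq_left mult.assoc)
  qed
  have "w = z ^ e * (\<Prod>j\<in>A. y j ^ k) / Y ^ 2"
    unfolding w_def Y2 using PA by simp
  also have "\<dots> = (\<Sum>m\<le>N. c m ^ 2 * z ^ (k * m + e) / Y ^ 2)"
    unfolding expansion by (simp add: sum_distrib_left sum_divide_distrib power_add mult_ac)
  also have "{..N} = Ev \<union> Od"
    by (auto simp: Ev_def Od_def)
  also have "(\<Sum>m\<in>Ev \<union> Od. c m ^ 2 * z ^ (k * m + e) / Y ^ 2) =
      (\<Sum>m\<in>Ev. c m ^ 2 * z ^ (k * m + e) / Y ^ 2) + (\<Sum>m\<in>Od. c m ^ 2 * z ^ (k * m + e) / Y ^ 2)"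
    by (intro sum.union_disjoint) (auto simp: Ev_def Od_def)
  also have "\<dots> = (sum root_term Ev) ^ 2 + (sum root_term Od) ^ 2 * z"
    unfolding power2_sum_char2 sum_distrib_right
    using even_term odd_term by (simp cong: sum.cong)
  finally have w: "w = (sum root_term Ev) ^ 2 + (sum root_term Od) ^ 2 * z" .
  have "theta n fr (int e) \<alpha> \<in> H10 n X fr"
  proof (rule theta_holomorphic)
    have "int e \<le> int (\<Sum>j\<in>{3..n+1}. \<alpha> j) - 2"
      using I unfolding I_set_def by auto
    then show "e + 2 \<le> (\<Sum>j\<in>{3..n+1}. \<alpha> j)"
      by linarith
  qed (use I in \<open>auto simp: I_set_def\<close>)
  then have "cartier n X fr t (theta n fr (int e) \<alpha>) = sum root_term Od \<cdot>\<^sub>\<Omega> diff fr z"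
    unfolding theta_of_nat w_def[symmetric] by (rule cartier_eq[OF t _ w])
  also have "\<dots> = (\<Sum>m\<in>Od. c m \<cdot>\<^sub>\<Omega>
      theta n fr (int ((k * m + e) div 2)) (\<lambda>j. alpha_hat k n \<alpha> j div 2))"
    unfolding theta_of_nat scale_scale Y_def[symmetric]
    by (rule ext) (simp only: sum_form_apply scale_def sum_distrib_right root_term_def
        times_divide_eq_right)
  finally show ?thesis
    unfolding Od_def c_def N_def .
qed

text \<open>Since \<open>k\<close> is odd, \<open>k m + r\<close> is odd for \<open>m = 2 s + 1\<close> if \<open>r\<close> is even, and for \<open>m = 2 s\<close> if \<open>r\<close>
  is odd.\<close>

lemma cartier_theta_even:
  fixes \<alpha> :: "nat \<Rightarrow> nat" and e :: nat
  defines "A \<equiv> odd_indices n \<alpha>"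
  assumes t: "t \<notin> range (\<lambda>f. f ^ CHAR('a))" and I: "(int e, \<alpha>) \<in> I_set k n"
    and "even e" and A: "A \<noteq> {}"
  shows "cartier n X fr t (theta n fr (int e) \<alpha>) =
    (\<Sum>s = 0..(card A - 1) div 2. \<kappa> (sqrt_char2 (q_coeff lam A s)) \<cdot>\<^sub>\<Omega>
      theta n fr (int s * int k + (int e - 1 + int k) div 2) (\<lambda>j. alpha_hat k n \<alpha> j div 2))"
  unfolding cartier_theta[OF t I] A_def[symmetric]
proof (rule sum.reindex_bij_witness[of _ "\<lambda>s. 2 * s + 1" "\<lambda>m. m div 2"])
  fix m assume "m \<in> {m \<in> {..card A}. odd (k * m + e)}"
  then have m: "odd m" "m \<le> card A"
    using \<open>even e\<close> by auto
  then show "2 * (m div 2) + 1 = m" "m div 2 \<in> {0..(card A - 1) div 2}"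
    by (auto elim!: oddE)
  obtain s k' e' where s: "m = 2 * s + 1" "k = 2 * k' + 1" "e = 2 * e'"
    using m(1) odd_k \<open>even e\<close> by (auto elim!: oddE evenE)
  have "int s * int k + (int e - 1 + int k) div 2 = int ((k * m + e) div 2)"
  proof -
    have "k * m + e = 2 * (s * k + k' + e') + 1"
      unfolding s by (simp add: algebra_simps)
    moreover have "int e - 1 + int k = 2 * (int e' + int k')"
      unfolding s by simp
    ultimately show ?thesis
      by simp
  qed
  then show "\<kappa> (sqrt_char2 (q_coeff lam A (m div 2))) \<cdot>\<^sub>\<Omega> theta n fr
      (int (m div 2) * int k + (int e - 1 + int k) div 2) (\<lambda>j. alpha_hat k n \<alpha> j div 2) =
    \<kappa> (sqrt_char2 (esym A \<delta> (card A - m))) \<cdot>\<^sub>\<Omega>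
      theta n fr (int ((k * m + e) div 2)) (\<lambda>j. alpha_hat k n \<alpha> j div 2)"
    by (simp add: s(1) q_coeff_def)
next
  have "finite A"
    by (simp add: A_def odd_indices_def)
  then have card: "card A > 0"
    using A by (simp add: card_gt_0_iff)
  fix s assume "s \<in> {0..(card A - 1) div 2}"
  then show "(2 * s + 1) div 2 = s" "2 * s + 1 \<in> {m \<in> {..card A}. odd (k * m + e)}"
    using card odd_k \<open>even e\<close> by auto
qed

lemma cartier_theta_odd:
  fixes \<alpha> :: "nat \<Rightarrow> nat" and e :: nat
  defines "A \<equiv> odd_indices n \<alpha>"
  assumes t: "t \<notin> range (\<lambda>f. f ^ CHAR('a))" and I: "(int e, \<alpha>) \<in> I_set k n" and "odd e"
  shows "cartier n X fr t (theta n fr (int e) \<alpha>) =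
    (\<Sum>s = 0..card A div 2. \<kappa> (sqrt_char2 (d_coeff lam A s)) \<cdot>\<^sub>\<Omega>
      theta n fr (int s * int k + (int e - 1) div 2) (\<lambda>j. alpha_hat k n \<alpha> j div 2))"
  unfolding cartier_theta[OF t I] A_def[symmetric]
proof (rule sum.reindex_bij_witness[of _ "\<lambda>s. 2 * s" "\<lambda>m. m div 2"])
  fix m assume "m \<in> {m \<in> {..card A}. odd (k * m + e)}"
  then have m: "even m" "m \<le> card A"
    using \<open>odd e\<close> odd_k by auto
  then show "2 * (m div 2) = m" "m div 2 \<in> {0..card A div 2}"
    by auto
  obtain s e' where s: "m = 2 * s" "e = 2 * e' + 1"
    using m(1) \<open>odd e\<close> by (auto elim!: oddE evenE)
  have "int s * int k + (int e - 1) div 2 = int ((k * m + e) div 2)"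
  proof -
    have "k * m + e = 2 * (s * k + e') + 1"
      unfolding s by (simp add: algebra_simps)
    moreover have "int e - 1 = 2 * int e'"
      unfolding s by simp
    ultimately show ?thesis
      by simp
  qed
  then show "\<kappa> (sqrt_char2 (d_coeff lam A (m div 2))) \<cdot>\<^sub>\<Omega> theta n fr
      (int (m div 2) * int k + (int e - 1) div 2) (\<lambda>j. alpha_hat k n \<alpha> j div 2) =
    \<kappa> (sqrt_char2 (esym A \<delta> (card A - m))) \<cdot>\<^sub>\<Omega>
      theta n fr (int ((k * m + e) div 2)) (\<lambda>j. alpha_hat k n \<alpha> j div 2)"
    by (simp add: s(1) d_coeff_def)
next
  fix s assume "s \<in> {0..card A div 2}"
  then show "2 * s div 2 = s" "2 * s \<in> {m \<in> {..card A}. odd (k * m + e)}"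
    using odd_k \<open>odd e\<close> by auto
qed

lemma sqrt_char2_1: "sqrt_char2 (1 :: 'a) = 1"
proof -
  have "sqrt_char2 (1 :: 'a) = 1 \<or> sqrt_char2 (1 :: 'a) = - 1"
    using sqrt_char2[OF char2, of 1] by (simp only: power2_eq_1_iff)
  moreover have "(1 :: 'a) = - 1"
    using add_self(1)[of 1] by (simp only: eq_neg_iff_add_eq_0)
  ultimately show ?thesis
    by metis
qed

lemma scale_1: "1 \<cdot>\<^sub>\<Omega> \<omega> = \<omega>"
  by (simp add: scale_def)

end

theorem theorem5p1:
  fixes k n :: nat
    and lam :: "nat \<Rightarrow> 'a::alg_closed_field"
    and fr :: "'a mpol \<Rightarrow> 'a mpol \<Rightarrow> 'f::field"
    and t :: 'f
    and r :: int
    and \<alpha> :: "nat \<Rightarrow> nat"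
  defines "F \<equiv> curve k n lam"
    and "A \<equiv> odd_indices n \<alpha>"
    and "half_hat \<equiv> (\<lambda>j. alpha_hat k n \<alpha> j div 2)"
    and "\<theta> \<equiv> theta n fr"
    and "C \<equiv> cartier n (curve k n lam) fr t"
  assumes "CHAR('a) = 2"
    and "k \<ge> 3" and "odd k" and "n \<ge> 2"
    and "\<forall>j\<in>{1..n-2}. lam j \<noteq> 0 \<and> lam j \<noteq> 1"
    and "inj_on lam {1..n-2}"
    and "is_function_field n F fr"
    and "t \<notin> range (\<lambda>f. f ^ CHAR('a))"
    and "(r, \<alpha>) \<in> I_set k n"
  shows
    "(even r \<and> A = {} \<longrightarrow> C (\<theta> r \<alpha>) = 0) \<and>
     (even r \<and> card A = 1 \<longrightarrow>
        C (\<theta> r \<alpha>) = \<theta> ((r + int k - 1) div 2) half_hat) \<and>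
     (even r \<and> card A \<ge> 2 \<and> even (card A) \<longrightarrow>
        C (\<theta> r \<alpha>) = (\<Sum>s = 0..(card A - 2) div 2.
          const_fun fr (sqrt_char2 (q_coeff lam A s)) \<cdot>\<^sub>\<Omega>
            \<theta> (int s * int k + (r - 1 + int k) div 2) half_hat)) \<and>
     (even r \<and> card A \<ge> 3 \<and> odd (card A) \<longrightarrow>
        C (\<theta> r \<alpha>) = (\<Sum>s = 0..(card A - 1) div 2.
          const_fun fr (sqrt_char2 (q_coeff lam A s)) \<cdot>\<^sub>\<Omega>
            \<theta> (int s * int k + (r - 1 + int k) div 2) half_hat)) \<and>
     (odd r \<and> A = {} \<longrightarrow>
        C (\<theta> r \<alpha>) = \<theta> ((r - 1) div 2) (\<lambda>j. \<alpha> j div 2)) \<and>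
     (\<forall>j0. odd r \<and> A = {j0} \<longrightarrow>
        C (\<theta> r \<alpha>) = const_fun fr (sqrt_char2 (delta lam j0)) \<cdot>\<^sub>\<Omega>
            \<theta> ((r - 1) div 2) ((\<lambda>j. \<alpha> j div 2)(j0 := (\<alpha> j0 + k) div 2))) \<and>
     (odd r \<and> card A \<ge> 2 \<and> even (card A) \<longrightarrow>
        C (\<theta> r \<alpha>) = (\<Sum>s = 0..card A div 2.
          const_fun fr (sqrt_char2 (d_coeff lam A s)) \<cdot>\<^sub>\<Omega>
            \<theta> (int s * int k + (r - 1) div 2) half_hat)) \<and>
     (odd r \<and> card A \<ge> 3 \<and> odd (card A) \<longrightarrow>
        C (\<theta> r \<alpha>) = (\<Sum>s = 0..(card A - 1) div 2.
          const_fun fr (sqrt_char2 (d_coeff lam A s)) \<cdot>\<^sub>\<Omega>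
            \<theta> (int s * int k + (r - 1) div 2) half_hat))"
proof -
  interpret char2_curve n k lam fr
    using assms by unfold_locales auto
  have finA: "finite A"
    by (simp add: A_def odd_indices_def)
  have "r \<ge> 0"
    using \<open>(r, \<alpha>) \<in> I_set k n\<close> by (simp add: I_set_def)
  then obtain e where r: "r = int e"
    by (rule nonneg_int_cases)
  note t = \<open>t \<notin> range (\<lambda>f. f ^ CHAR('a))\<close>
  have I: "(int e, \<alpha>) \<in> I_set k n"
    using \<open>(r, \<alpha>) \<in> I_set k n\<close> r by simp
  note image = cartier_theta[OF t I, folded A_def half_hat_def \<theta>_def C_def r]
  have image_even: "C (\<theta> r \<alpha>) = (\<Sum>s = 0..(card A - 1) div 2.
      \<kappa> (sqrt_char2 (q_coeff lam A s)) \<cdot>\<^sub>\<Omega> \<theta> (int s * int k + (r - 1 + int k) div 2) half_hat)"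
    if "even r" "A \<noteq> {}"
    using cartier_theta_even[OF t I] that
    by (simp add: r A_def half_hat_def \<theta>_def C_def)
  have image_odd: "C (\<theta> r \<alpha>) = (\<Sum>s = 0..card A div 2.
      \<kappa> (sqrt_char2 (d_coeff lam A s)) \<cdot>\<^sub>\<Omega> \<theta> (int s * int k + (r - 1) div 2) half_hat)"
    if "odd r"
    using cartier_theta_odd[OF t I] that
    by (simp add: r A_def half_hat_def \<theta>_def C_def)
  have half_hat: "half_hat j = (if j \<in> A then (k + \<alpha> j) div 2 else \<alpha> j div 2)" for j
    by (simp add: half_hat_def alpha_hat_def A_def)
  have 1: "C (\<theta> r \<alpha>) = 0" if "even r" "A = {}"
  proof -
    have "{m \<in> {..card A}. odd (k * m + e)} = {}"
      using that r by auto
    then show ?thesis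
      unfolding image by (simp only: sum.empty)
  qed
  have 2: "C (\<theta> r \<alpha>) = \<theta> ((r + int k - 1) div 2) half_hat" if "even r" "card A = 1"
  proof -
    have "q_coeff lam A 0 = 1"
      using that finA by (simp add: q_coeff_def esym_0)
    moreover have "A \<noteq> {}"
      using that by auto
    ultimately show ?thesis
      using image_even that by (simp add: sqrt_char2_1 scale_1 algebra_simps)
  qed
  have 3: "C (\<theta> r \<alpha>) = (\<Sum>s = 0..(card A - 2) div 2.
      const_fun fr (sqrt_char2 (q_coeff lam A s)) \<cdot>\<^sub>\<Omega>
        \<theta> (int s * int k + (r - 1 + int k) div 2) half_hat)"
    if "even r" "card A \<ge> 2" "even (card A)"
  proof -
    have "(card A - 1) div 2 = (card A - 2) div 2"
      using that(2,3) by presburger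
    moreover have "A \<noteq> {}"
      using that by auto
    ultimately show ?thesis
      using image_even[OF that(1)] by simp
  qed
  have 4: "C (\<theta> r \<alpha>) = (\<Sum>s = 0..(card A - 1) div 2. const_fun fr (sqrt_char2 (q_coeff lam A s))
      \<cdot>\<^sub>\<Omega> \<theta> (int s * int k + (r - 1 + int k) div 2) half_hat)"
    if "even r" "card A \<ge> 3"
  proof -
    have "A \<noteq> {}"
      using that by auto
    then show ?thesis
      by (rule image_even[OF that(1)])
  qed
  have 5: "C (\<theta> r \<alpha>) = \<theta> ((r - 1) div 2) (\<lambda>j. \<alpha> j div 2)" if "odd r" "A = {}"
  proof -
    have "half_hat = (\<lambda>j. \<alpha> j div 2)"
      using that(2) by (simp add: fun_eq_iff half_hat)
    then show ?thesis
      using image_odd that by (simp add: d_coeff_def esym_0 sqrt_char2_1 scale_1)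
  qed
  have 6: "C (\<theta> r \<alpha>) = const_fun fr (sqrt_char2 (delta lam j0)) \<cdot>\<^sub>\<Omega>
      \<theta> ((r - 1) div 2) ((\<lambda>j. \<alpha> j div 2)(j0 := (\<alpha> j0 + k) div 2))"
    if "odd r" "A = {j0}" for j0
  proof -
    have "half_hat = (\<lambda>j. \<alpha> j div 2)(j0 := (\<alpha> j0 + k) div 2)"
      using that(2) by (simp add: fun_eq_iff half_hat add.commute)
    then show ?thesis
      using image_odd that by (simp add: d_coeff_def esym_singleton[unfolded One_nat_def])
  qed
  have 8: "C (\<theta> r \<alpha>) = (\<Sum>s = 0..(card A - 1) div 2. const_fun fr (sqrt_char2 (d_coeff lam A s))
      \<cdot>\<^sub>\<Omega> \<theta> (int s * int k + (r - 1) div 2) half_hat)"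
    if "odd r" "odd (card A)"
  proof -
    have "(card A - 1) div 2 = card A div 2"
      using that(2) by presburger
    then show ?thesis
      using image_odd that(1) by simp
  qed
  show ?thesis
    by (intro conjI allI impI; elim conjE) (rule 1 2 3 4 5 6 image_odd 8; assumption)+
qed

end
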